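(* Let $n>m$ be positive integers and let $A\in IMS2(n,m)$. There exists a data structure of ${\rm O}\left(nm\left(\log\log\frac{n}{m}\right)^2\right)$ bits that, given indices $(i,j)$, returns $A[i][j]$ in ${\rm O}\left(\log\log\frac{n}{m}\right)$ time.
   Context: $IMS2(n,m)$ is the set of two-dimensional integer arrays $A[0..n-1][0..n-1]$ satisfying three conditions: - $A[i][j]\le A[i][j+1]$ for $0\le i<n$ and $0\le j<n-1$; - $A[i][j]\le A[i+1][j]$ for $0\le i<n-1$ and $0\le j<n$; - $0\le A[i][j]<m$ for all $i,j$. Space is measured in bits, in the word-RAM model. *)

theory Defs
  imports Complex_Main
begin

section \<open>Sorted integer matrices\<close>

text \<open>Only the entries with both indices below \<open>n\<close> matter; the other values of the function are
  unconstrained.\<close>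

definition IMS2 :: "nat \<Rightarrow> nat \<Rightarrow> (nat \<Rightarrow> nat \<Rightarrow> int) set" where
  "IMS2 n m = {A.
     (\<forall>i j. i < n \<and> j + 1 < n \<longrightarrow> A i j \<le> A i (j + 1)) \<and>
     (\<forall>i j. i + 1 < n \<and> j < n \<longrightarrow> A i j \<le> A (i + 1) j) \<and>
     (\<forall>i j. i < n \<and> j < n \<longrightarrow> 0 \<le> A i j \<and> A i j < int m)}"

text \<open>For \<open>x > 1\<close> the iterated logarithm may be zero or negative; as usual inside an O-bound it is
  replaced by 1 where it drops below 1.\<close>

definition loglog :: "real \<Rightarrow> real" where
  "loglog x = max 1 (log 2 (log 2 x))"


section \<open>Word RAM\<close>

text \<open>Words of \<open>w\<close> bits are natural numbers below \<open>2 ^ w\<close>, because \<open>w\<close> is quantified over and so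
  cannot be a type parameter. A program mentions finitely many registers, so the working storage
  outside the memory is a constant number of words.\<close>

datatype binop = Add | Sub | Mul | Div | Mod | And | Or | Xor | Shl | Shr

datatype instr =
    Const nat nat             \<comment> \<open>destination, constant\<close>
  | WordSize nat              \<comment> \<open>destination; loads \<open>w\<close>\<close>
  | Binop binop nat nat nat   \<comment> \<open>destination, two operands\<close>
  | Load nat nat              \<comment> \<open>destination, register holding the address\<close>
  | Store nat nat             \<comment> \<open>register holding the address, source\<close>
  | Jump nat                  \<comment> \<open>target\<close>
  | JumpLess nat nat nat      \<comment> \<open>two operands, target\<close>
  | JumpEq nat nat nat        \<comment> \<open>two operands, target\<close>
  | Halt

record state =
  pc :: nat
  regs :: "nat \<Rightarrow> nat"
  mem :: "nat list"

fun binop_sem :: "nat \<Rightarrow> binop \<Rightarrow> nat \<Rightarrow> nat \<Rightarrow> nat" where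
  "binop_sem w Add a b = take_bit w (a + b)"
| "binop_sem w Sub a b = nat ((int a - int b) mod 2 ^ w)"
| "binop_sem w Mul a b = take_bit w (a * b)"
| "binop_sem w Div a b = a div b"
| "binop_sem w Mod a b = a mod b"
| "binop_sem w And a b = semiring_bit_operations_class.and a b"
| "binop_sem w Or a b = semiring_bit_operations_class.or a b"
| "binop_sem w Xor a b = semiring_bit_operations_class.xor a b"
| "binop_sem w Shl a b = take_bit w (push_bit b a)"
| "binop_sem w Shr a b = drop_bit b a"

definition set_reg :: "nat \<Rightarrow> nat \<Rightarrow> state \<Rightarrow> state" where
  "set_reg d v s = s\<lparr>pc := pc s + 1, regs := (regs s)(d := v)\<rparr>"

text \<open>The memory consists of exactly the given words: an access beyond its end has no successor
  state, so all memory that a program touches is accounted for.\<close>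

fun instr_sem :: "nat \<Rightarrow> instr \<Rightarrow> state \<Rightarrow> state option" where
  "instr_sem w (Const d k) s = Some (set_reg d (take_bit w k) s)"
| "instr_sem w (WordSize d) s = Some (set_reg d (take_bit w w) s)"
| "instr_sem w (Binop f d a b) s = Some (set_reg d (binop_sem w f (regs s a) (regs s b)) s)"
| "instr_sem w (Load d a) s =
     (if regs s a < length (mem s) then Some (set_reg d (mem s ! regs s a) s) else None)"
| "instr_sem w (Store a b) s =
     (if regs s a < length (mem s)
      then Some (s\<lparr>pc := pc s + 1, mem := (mem s)[regs s a := regs s b]\<rparr>) else None)"
| "instr_sem w (Jump l) s = Some (s\<lparr>pc := l\<rparr>)"
| "instr_sem w (JumpLess a b l) s =
     Some (s\<lparr>pc := (if regs s a < regs s b then l else pc s + 1)\<rparr>)"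
| "instr_sem w (JumpEq a b l) s =
     Some (s\<lparr>pc := (if regs s a = regs s b then l else pc s + 1)\<rparr>)"
| "instr_sem w Halt s = None"

definition step :: "nat \<Rightarrow> instr list \<Rightarrow> state \<Rightarrow> state option" where
  "step w P s = (if pc s < length P then instr_sem w (P ! pc s) s else None)"

primrec run :: "nat \<Rightarrow> instr list \<Rightarrow> nat \<Rightarrow> state \<Rightarrow> state option" where
  "run w P 0 s = Some s"
| "run w P (Suc t) s = Option.bind (step w P s) (run w P t)"

definition halted :: "instr list \<Rightarrow> state \<Rightarrow> bool" where
  "halted P s \<longleftrightarrow> pc s < length P \<and> P ! pc s = Halt"


section \<open>Data structures\<close>

text \<open>A data structure is a bit string, stored in consecutive words with the least significant bit
  first; the last word is padded with zeros.\<close>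

definition pack :: "nat \<Rightarrow> bool list \<Rightarrow> nat list" where
  "pack w bs = map (\<lambda>k. horner_sum of_bool 2 (take w (drop (k * w) bs)))
                   [0..<(length bs + w - 1) div w]"

definition query_state :: "nat \<Rightarrow> bool list \<Rightarrow> nat \<Rightarrow> nat \<Rightarrow> state" where
  "query_state w bs i j = \<lparr>pc = 0, regs = (\<lambda>_. 0)(0 := i, 1 := j), mem = pack w bs\<rparr>"

text \<open>The answer is delivered in register 0. The memory has to be left as it was found, so that
  the data structure can serve any sequence of queries.\<close>

definition answers_within ::
    "nat \<Rightarrow> instr list \<Rightarrow> bool list \<Rightarrow> nat \<Rightarrow> nat \<Rightarrow> int \<Rightarrow> real \<Rightarrow> bool" where
  "answers_within w P bs i j x T \<longleftrightarrow>
     (\<exists>t s. real t \<le> T \<and> run w P t (query_state w bs i j) = Some s \<and> halted P s \<and>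
            int (regs s 0) = x \<and> mem s = pack w bs)"

end

theory Submission
  imports Defs "HOL-Library.Nat_Bijection"
begin

text \<open>Extend \<open>A\<close> to a square of side \<open>2 ^ k\<close> and cut it recursively into dyadic blocks. A block whose
  range (last minus first entry) is 0 needs no data. Along a diagonal of blocks the ranges add up to
  less than \<open>m\<close>, so the ranges of all blocks of side \<open>s\<close> sum to \<open>O(n m / s)\<close>, and a node with block
  side \<open>s\<close> and range \<open>d > 0\<close> may spend \<open>O(s d)\<close> bits at each level of the recursion.

  If \<open>n / m\<close> is at least about the cube root of \<open>log n\<close>, the top grid consists of blocks whose side is
  about \<open>(n / m)\<^sup>2\<close>, and from there side \<open>s\<close> is split into side \<open>s\<close> to the power \<open>3 / 4\<close>. The
  \<open>s\<close> to the power \<open>1 / 2\<close> records of \<open>O(log s + log d)\<close> bits fit into \<open>O(s d)\<close>, and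
  \<open>O(log log (n / m))\<close> levels reach single cells. Otherwise two grids lead to blocks of side
  \<open>s\<close> about the cube root of \<open>log n\<close>. Those of range \<open>d = O(s\<^sup>2)\<close> are addressed by a code of
  \<open>2 s d\<close> bits in a shared table of all such blocks, the others are stored cell by cell.\<close>

section \<open>Straight-line code on the word RAM\<close>

text \<open>The cube root of log n comes from the top grid, whose records need O(log n) bits. With
  blocks of side s it has O((n / s)^2) records and stays within O(n m) bits only if s^2 is at least
  about (n / m) log n; for s = (n / m)^2 this says that (n / m)^3 is at least about log n. Below
  this threshold s has to grow with n even when n / m is bounded, and repeated splitting would take
  a number of levels that depends on n. There the shared table ends the search after a constant
  number of steps. The exponent 3/4 replaces the more obvious 1/2, because s records of log s bits
  would exceed O(s d) already for d = 1. One program has to serve all n, m and w. Therefore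
  everything that varies, field widths included, is stored in the bit string, and all sides are
  powers of two, so that block coordinates are shifts and masks.\<close>

fun straight_sem :: "nat \<Rightarrow> nat list \<Rightarrow> instr \<Rightarrow> (nat \<Rightarrow> nat) \<Rightarrow> (nat \<Rightarrow> nat) option" where
  "straight_sem w M (Const d k) R = Some (R(d := take_bit w k))"
| "straight_sem w M (WordSize d) R = Some (R(d := take_bit w w))"
| "straight_sem w M (Binop f d a b) R = Some (R(d := binop_sem w f (R a) (R b)))"
| "straight_sem w M (Load d a) R = (if R a < length M then Some (R(d := M ! R a)) else None)"
| "straight_sem w M _ R = None"

text \<open>Jumps, stores and \<open>Halt\<close> are excluded, so the memory stays fixed and the
  program counter just advances. A code fragment becomes a partial function on register contents,
  which \<open>run_exec\<close> places at any position of a program.\<close>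

primrec exec :: "nat \<Rightarrow> nat list \<Rightarrow> instr list \<Rightarrow> (nat \<Rightarrow> nat) \<Rightarrow> (nat \<Rightarrow> nat) option" where
  "exec w M [] R = Some R"
| "exec w M (x # xs) R = Option.bind (straight_sem w M x R) (exec w M xs)"

lemma exec_append: "exec w M (xs @ ys) R = Option.bind (exec w M xs R) (exec w M ys)"
  by (induction xs arbitrary: R) (auto split: Option.bind_splits)

lemma run_add: "run w P (a + b) s = Option.bind (run w P a s) (run w P b)"
proof (induction a arbitrary: s)
  case (Suc a)
  show ?case
    unfolding add_Suc run.simps(2)[of w P _ s] by (cases "step w P s") (simp_all add: Suc)
qed simp

lemma instr_sem_straight:
  assumes "straight_sem w M x R = Some R'"
  shows "instr_sem w x \<lparr>pc = k, regs = R, mem = M\<rparr> = Some \<lparr>pc = Suc k, regs = R', mem = M\<rparr>"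
  using assms by (cases x) (auto simp: set_reg_def split: if_splits)

lemma run_exec:
  assumes "exec w M xs R = Some R'"
  shows "run w (us @ xs @ ys) (length xs) \<lparr>pc = length us, regs = R, mem = M\<rparr> =
         Some \<lparr>pc = length us + length xs, regs = R', mem = M\<rparr>"
  using assms
proof (induction xs arbitrary: us R)
  case (Cons x xs)
  then obtain R1 where R1: "straight_sem w M x R = Some R1" "exec w M xs R1 = Some R'"
    by (auto simp: bind_eq_Some_conv)
  have "step w (us @ (x # xs) @ ys) \<lparr>pc = length us, regs = R, mem = M\<rparr> =
        Some \<lparr>pc = Suc (length us), regs = R1, mem = M\<rparr>"
    using instr_sem_straight[OF R1(1)] by (simp add: step_def)
  then show ?case
    using Cons.IH[of R1 "us @ [x]"] R1(2) by (simp only: list.size run.simps) simp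
qed simp

section \<open>The query program\<close>

definition bits_val :: "bool list \<Rightarrow> nat" where
  "bits_val bs = horner_sum of_bool 2 bs"

definition fld :: "bool list \<Rightarrow> nat \<Rightarrow> nat \<Rightarrow> nat" where
  "fld bs p W = take_bit W (drop_bit p (bits_val bs))"

lemma bit_bits_val: "bit (bits_val bs) k \<longleftrightarrow> k < length bs \<and> bs ! k"
  by (simp add: bits_val_def bit_horner_sum_bit_iff)

lemma bits_val_take_drop: "bits_val (take W (drop p bs)) = fld bs p W"
  by (rule bit_eqI) (auto simp: fld_def bit_bits_val bit_take_bit_iff bit_drop_bit_eq)

lemma fld_drop: "fld (us @ bs) (length us + p) W = fld bs p W"
  by (rule bit_eqI) (auto simp: fld_def bit_bits_val bit_take_bit_iff bit_drop_bit_eq nth_append)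

lemma length_pack: "length (pack w bs) = (length bs + w - 1) div w"
  by (simp add: pack_def)

lemma pack_nth:
  assumes "0 < w" "p < length bs"
  shows "p div w < length (pack w bs)" "pack w bs ! (p div w) = fld bs (p div w * w) w"
proof -
  show *: "p div w < length (pack w bs)"
  proof -
    have "p div w + 1 = (p + w) div w" using assms by simp
    also have "\<dots> \<le> (length bs + w - 1) div w" using assms by (intro div_le_mono) auto
    finally show ?thesis by (simp add: length_pack)
  qed
  show "pack w bs ! (p div w) = fld bs (p div w * w) w"
    using * by (simp add: length_pack) (simp add: pack_def bits_val_take_drop[symmetric] bits_val_def)
qed

text \<open>Registers of the loop: 0 and 1 hold the indices, 2 the value collected so far, 3 to 6
  the position \<open>p\<close> and the parameters \<open>W\<close>, \<open>q\<close>,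
  \<open>r\<close> of the current node, 7 the length of the header, 8 to 10 the constants 1, 6, 0,
  and 11 the word size. Registers 12 to 15 are scratch.\<close>

definition body_index :: "instr list" where
  "body_index =
    [Binop Shr 12 0 5, Binop Shl 12 12 6, Binop Shr 13 1 5, Binop Add 12 12 13,
     Binop Shl 13 8 5, Binop Sub 13 13 8, Binop And 0 0 13, Binop And 1 1 13,
     Binop Mul 14 4 9, Binop Mul 12 12 14, Binop Add 12 12 3, Binop Add 12 12 7]"

text \<open>The second word is the one that holds the last of the \<open>L\<close> bits, so that memory is never overrun.
  If it coincides with the first one, its contribution lies col_count bit \<open>L\<close>.\<close>

definition body_read :: "instr list" where
  "body_read =
    [Binop Div 13 12 11, Load 13 13, Binop Mod 15 12 11, Binop Shr 13 13 15, Binop Sub 15 11 15,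
     Binop Add 12 12 14, Binop Sub 12 12 8, Binop Div 12 12 11, Load 12 12, Binop Shl 12 12 15,
     Binop Or 12 12 13]"

text \<open>The fields are peeled off from the low end. Register 4 is overwritten last, because the
  shifts need the old width until then.\<close>

definition body_fields :: "instr list" where
  "body_fields =
    [Binop Shl 13 8 4, Binop Sub 13 13 8,
     Binop And 14 12 13, Binop Add 2 2 14, Binop Shr 12 12 4,
     Binop And 14 12 13, Binop Mul 3 3 14, Binop Shr 12 12 4,
     Binop And 14 12 13, Binop Add 3 3 14, Binop Shr 12 12 4,
     Binop And 5 12 13, Binop Shr 12 12 4,
     Binop And 6 12 13, Binop Shr 12 12 4,
     Binop And 4 12 13]"

section \<open>Correctness of the three pieces of the loop body\<close>

lemma take_bit_idem_nat: "(a::nat) < 2 ^ w \<Longrightarrow> take_bit w a = a"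
  by (simp add: take_bit_nat_eq_self)

lemma sem_Sub: "a < 2 ^ w \<Longrightarrow> b \<le> a \<Longrightarrow> binop_sem w Sub a b = a - b"
proof -
  assume "a < 2 ^ w" "b \<le> a"
  have "int a < 2 ^ w" using \<open>a < 2 ^ w\<close> by (metis of_nat_less_iff of_nat_numeral of_nat_power)
  then have "(int a - int b) mod 2 ^ w = int a - int b" using \<open>b \<le> a\<close>
    by (intro mod_pos_pos_trivial) linarith+
  then show ?thesis using \<open>b \<le> a\<close> by simp
qed

text \<open>For \<open>q >= w\<close> the shift yields 0, and subtracting 1 wraps around to the full
  word. The search starts with \<open>q = w\<close>, so this case does occur.\<close>

lemma sem_mask:
  assumes "0 < w"
  shows "binop_sem w Sub (binop_sem w Shl 1 q) 1 = mask (min q w)"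
proof (cases "q < w")
  case True
  then have "(2::nat) ^ q < 2 ^ w" by simp
  then have "binop_sem w Shl 1 q = 2 ^ q" by (simp add: take_bit_idem_nat push_bit_eq_mult)
  then show ?thesis
    using True sem_Sub[of "2 ^ q" w 1] by (simp add: mask_eq_exp_minus_1 del: binop_sem.simps)
next
  case False
  then have "binop_sem w Shl 1 q = 0"
    by (simp add: push_bit_eq_mult take_bit_eq_mod le_imp_power_dvd mod_eq_0_iff_dvd)
  moreover have "(-1::int) mod 2 ^ w = 2 ^ w - 1" by (simp add: zmod_minus1)
  ultimately show ?thesis using False by (simp add: mask_eq_exp_minus_1 nat_diff_distrib nat_power_eq)
qed

lemma sem_And_mask:
  assumes "i < 2 ^ w"
  shows "binop_sem w And i (mask (min q w)) = i mod 2 ^ q"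
proof -
  have "binop_sem w And i (mask (min q w)) = take_bit (min q w) i"
    by (simp add: take_bit_eq_mask)
  also have "\<dots> = take_bit q (take_bit w i)" by (simp add: take_bit_take_bit)
  also have "take_bit w i = i" using assms by (rule take_bit_idem_nat)
  finally show ?thesis by (simp add: take_bit_eq_mod)
qed

lemma exec_index:
  assumes R: "R 0 = i" "R 1 = j" "R 3 = p" "R 4 = W" "R 5 = q" "R 6 = r" "R 7 = H" "R 8 = 1" "R 9 = 6"
    and w: "0 < w" "i < 2 ^ w" "j < 2 ^ w" "0 < W"
    and small: "H + p + 6 * W * (i div 2 ^ q * 2 ^ r + j div 2 ^ q) < 2 ^ w" "6 * W < 2 ^ w"
  shows "\<exists>R'. exec w M body_index R = Some R' \<and> R' 0 = i mod 2 ^ q \<and> R' 1 = j mod 2 ^ q \<and>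
           R' 12 = H + p + 6 * W * (i div 2 ^ q * 2 ^ r + j div 2 ^ q) \<and> R' 14 = 6 * W \<and>
           (\<forall>k. k \<in> {2,3,4,5,6,7,8,9,10,11} \<longrightarrow> R' k = R k)"
proof -
  define a where "a = i div 2 ^ q * 2 ^ r"
  define x where "x = a + j div 2 ^ q"
  \<comment> \<open>All intermediate results except \<open>6 * W\<close> are at most the final
    address, so the bound on the address excludes their overflow.\<close>
  have x: "x \<le> 6 * W * x" using w by simp
  have x1: "6 * W * x < 2 ^ w" "p + 6 * W * x < 2 ^ w" using small unfolding x_def a_def by linarith+
  have x2: "x < 2 ^ w" using x x1 by linarith
  have x3: "a < 2 ^ w" using x2 unfolding x_def by linarith
  have e1: "push_bit r (drop_bit q i) = a" and e2: "a + drop_bit q j = x"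
    by (simp_all add: a_def x_def push_bit_eq_mult drop_bit_eq_div)
  have e: "binop_sem w Shl (binop_sem w Shr i q) r = a"
    "binop_sem w Add a (binop_sem w Shr j q) = x"
    "binop_sem w Mul W 6 = 6 * W"
    "binop_sem w Mul x (6 * W) = 6 * W * x"
    "binop_sem w Add (6 * W * x) p = p + 6 * W * x"
    "binop_sem w Add (p + 6 * W * x) H = H + p + 6 * W * x"
    using x1 x2 x3 small unfolding x_def[symmetric] a_def[symmetric]
    by (simp_all add: take_bit_idem_nat mult_ac add_ac e1 e2)
  show ?thesis
    unfolding body_index_def x_def[symmetric] a_def[symmetric]
    by (simp add: R e sem_mask[OF w(1)] sem_And_mask[OF w(2)] sem_And_mask[OF w(3)]
        del: binop_sem.simps One_nat_def)
qed

text \<open>Only the low \<open>L\<close> bits of the result are described: whatever follows them in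
  memory remains above them and is masked off when the fields are extracted.\<close>

lemma exec_read:
  assumes R: "R 12 = a" "R 14 = L" "R 11 = w" "R 8 = 1"
    and w: "0 < w" "0 < L" "L \<le> w" "a + L \<le> length bs" "length bs < 2 ^ w"
  shows "\<exists>R'. exec w (pack w bs) body_read R = Some R' \<and> take_bit L (R' 12) = fld bs a L \<and>
           (\<forall>k. k \<notin> {12,13,14,15} \<longrightarrow> R' k = R k)"
proof -
  define o1 where "o1 = a mod w"
  define x1 where "x1 = drop_bit o1 (fld bs (a div w * w) w)"
  define d where "d = (a + L - 1) div w"
  define x2 where "x2 = take_bit w (push_bit (w - o1) (fld bs (d * w) w))"
  have o1: "o1 < w" using w by (simp add: o1_def)
  have ww: "w < 2 ^ w" by simp
  have m1: "a div w < length (pack w bs)" "pack w bs ! (a div w) = fld bs (a div w * w) w"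
    using pack_nth[of w a bs] w by auto
  have m2: "d < length (pack w bs)" "pack w bs ! d = fld bs (d * w) w"
    using pack_nth[of w "a + L - 1" bs] w unfolding d_def by auto
  have e: "binop_sem w Sub w o1 = w - o1"
    "binop_sem w Add a L = a + L"
    "binop_sem w Sub (a + L) 1 = a + L - 1"
    using sem_Sub[OF ww, of o1] sem_Sub[of "a + L" w 1] o1 w
    by (simp_all add: take_bit_idem_nat del: binop_sem.simps(2))
  have f: "binop_sem w Div a w = a div w" "binop_sem w Mod a w = o1"
    "binop_sem w Div (a + L - 1) w = d"
    "binop_sem w Shr (fld bs (a div w * w) w) o1 = x1"
    "binop_sem w Shl (fld bs (d * w) w) (w - o1) = x2"
    "binop_sem w Or x2 x1 = semiring_bit_operations_class.or x2 x1"
    by (simp_all add: o1_def d_def x1_def x2_def)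
  have "\<exists>R'. exec w (pack w bs) body_read R = Some R' \<and> R' 12 = semiring_bit_operations_class.or x2 x1 \<and>
           (\<forall>k. k \<notin> {12,13,14,15} \<longrightarrow> R' k = R k)"
    unfolding body_read_def by (simp add: R e f m1 m2 del: binop_sem.simps One_nat_def)
  moreover have "take_bit L (semiring_bit_operations_class.or x2 x1) = fld bs a L"
  proof (rule bit_eqI)
    fix k
    have a: "a = a div w * w + o1" by (simp add: o1_def)
    have *: "bit (semiring_bit_operations_class.or x2 x1) k \<longleftrightarrow> bit (bits_val bs) (a + k)" if k: "k < L"
    \<comment> \<open>\<open>x1\<close> has no bits from position \<open>w - o1\<close> on and
      \<open>x2\<close> has none below it, so each position receives its bit from exactly one of the
      two words.\<close>
    proof (cases "o1 + k < w")
      case True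
      have "a div w * w + (k + o1) = a + k" using a by linarith
      then show ?thesis using True k w
        by (auto simp: x1_def x2_def bit_or_iff bit_take_bit_iff bit_push_bit_iff bit_drop_bit_eq fld_def add_ac)
    next
      case False
      have "a + L - 1 = a div w * w + (o1 + L - 1)" using a w(2) by linarith
      then have "d = a div w + (o1 + L - 1) div w"
        unfolding d_def using w(1) by (simp only: div_mult_self3)
      moreover have "(o1 + L - 1) div w = 1" using False k o1 w by (intro div_nat_eqI) auto
      ultimately have d: "d * w = a div w * w + w" by (simp add: algebra_simps)
      have "d * w + (k - (w - o1)) = a + k" using d a False o1 by linarith
      then show ?thesis using False k w o1
        by (auto simp: x1_def x2_def bit_or_iff bit_take_bit_iff bit_push_bit_iff bit_drop_bit_eq fld_def add_ac)
    qed
    show "bit (take_bit L (semiring_bit_operations_class.or x2 x1)) k \<longleftrightarrow> bit (fld bs a L) k"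
      using * by (auto simp: bit_take_bit_iff fld_def bit_drop_bit_eq simp del: take_bit_or)
  qed
  ultimately show ?thesis by auto
qed

text \<open>A record with child width 0 may contain an arbitrary offset, so register 3 is described
  only if the search continues.\<close>

lemma exec_fields:
  assumes R: "R 2 = v" "R 3 = p" "R 4 = W" "R 8 = 1" "take_bit (6 * W) (R 12) = fld bs a (6 * W)"
    and w: "0 < w" "W < w" "v + fld bs a W < 2 ^ w"
    and p: "fld bs (a + 5 * W) W \<noteq> 0 \<Longrightarrow> fld bs (a + W) W * p + fld bs (a + 2 * W) W < 2 ^ w"
  shows "\<exists>R'. exec w M body_fields R = Some R' \<and> R' 2 = v + fld bs a W \<and>
           (fld bs (a + 5 * W) W \<noteq> 0 \<longrightarrow> R' 3 = fld bs (a + W) W * p + fld bs (a + 2 * W) W) \<and>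
           R' 5 = fld bs (a + 3 * W) W \<and> R' 6 = fld bs (a + 4 * W) W \<and> R' 4 = fld bs (a + 5 * W) W \<and>
           (\<forall>k. k \<in> {0,1,7,8,9,10,11} \<longrightarrow> R' k = R k)"
proof -
  have f: "take_bit W (drop_bit (l * W) (R 12)) = fld bs (a + l * W) W" if "l < 6" for l
  proof (rule bit_eqI)
    fix k
    have "l * W + W \<le> 6 * W" using that by (metis Suc_leI add.commute mult_Suc mult_le_mono1)
    then have "bit (take_bit (6 * W) (R 12)) (l * W + k) = bit (fld bs a (6 * W)) (l * W + k)" if "k < W"
      using R by simp
    then show "bit (take_bit W (drop_bit (l * W) (R 12))) k = bit (fld bs (a + l * W) W) k"
      using \<open>l * W + W \<le> 6 * W\<close>
      by (auto simp: bit_take_bit_iff bit_drop_bit_eq fld_def add_ac)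
  qed
  have mk: "binop_sem w Sub (binop_sem w Shl 1 W) 1 = mask W"
    using sem_mask[OF w(1), of W] w(2) by (simp del: binop_sem.simps)
  have am: "binop_sem w And x (mask W) = take_bit W x" for x :: nat
    by (simp add: take_bit_eq_mask)
  have v: "binop_sem w Add v (fld bs a W) = v + fld bs a W" using w by (simp add: take_bit_idem_nat)
  have p': "binop_sem w Add (binop_sem w Mul p x) y = take_bit w (x * p + y)" for x y :: nat
    by (simp add: take_bit_eq_mod mod_add_left_eq mult.commute)
  have p3: "fld bs (a + 5 * W) W \<noteq> 0 \<Longrightarrow>
      take_bit w (fld bs (a + W) W * p + fld bs (a + 2 * W) W) = fld bs (a + W) W * p + fld bs (a + 2 * W) W"
    using p by (simp add: take_bit_idem_nat)
  have sh: "binop_sem w Shr x y = drop_bit y x" for x y by simp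
  have fs: "take_bit W (R 12) = fld bs a W" "take_bit W (drop_bit W (R 12)) = fld bs (a + W) W"
    "take_bit W (drop_bit (W + W) (R 12)) = fld bs (a + 2 * W) W"
    "take_bit W (drop_bit (W + (W + W)) (R 12)) = fld bs (a + 3 * W) W"
    "take_bit W (drop_bit (W + (W + (W + W))) (R 12)) = fld bs (a + 4 * W) W"
    "take_bit W (drop_bit (W + (W + (W + (W + W)))) (R 12)) = fld bs (a + 5 * W) W"
    using f[of 0] f[of 1] f[of 2] f[of 3] f[of 4] f[of 5]
    by (simp_all add: algebra_simps eval_nat_numeral)
  show ?thesis
    unfolding body_fields_def
    by (simp add: R mk am sh drop_bit_drop_bit fs v p' p3 add.assoc del: binop_sem.simps One_nat_def)
qed

text \<open>A node at bit position \<open>p\<close> is an array of \<open>2 ^ r\<close> by \<open>2 ^ r\<close> records, one per block of side \<open>2 ^ q\<close>.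
  A record has six fields of \<open>W\<close> bits: the increment of the value, a flag, an offset, and the parameters
  \<open>q\<close>, \<open>r\<close>, \<open>W\<close> of the child; child width 0 ends the search. The child starts at \<open>flag * p + offset\<close>:
  flag 1 makes the offset relative to the node (short pointers), flag 0 absolute (shared nodes).\<close>

inductive walk :: "nat \<Rightarrow> bool list \<Rightarrow> nat \<Rightarrow> nat \<Rightarrow> nat \<Rightarrow> nat \<Rightarrow> nat \<Rightarrow> nat \<Rightarrow> nat \<Rightarrow> nat \<Rightarrow> bool"
  for B :: nat and bs :: "bool list" where
  stop: "\<lbrakk>0 < W; W \<le> B; a = p + 6 * W * (i div 2 ^ q * 2 ^ r + j div 2 ^ q); a + 6 * W \<le> length bs;
          fld bs (a + 5 * W) W = 0; y = fld bs a W\<rbrakk>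
         \<Longrightarrow> walk B bs (Suc t) p W q r i j y"
| down: "\<lbrakk>0 < W; W \<le> B; a = p + 6 * W * (i div 2 ^ q * 2 ^ r + j div 2 ^ q); a + 6 * W \<le> length bs;
          walk B bs t (fld bs (a + W) W * p + fld bs (a + 2 * W) W) (fld bs (a + 5 * W) W)
            (fld bs (a + 3 * W) W) (fld bs (a + 4 * W) W) (i mod 2 ^ q) (j mod 2 ^ q) y'; y = fld bs a W + y'\<rbrakk>
         \<Longrightarrow> walk B bs (Suc t) p W q r i j y"

text \<open>Applied to the walk of a child: its width is nonzero, so the loop continues, and its
  computed position cannot overflow a word.\<close>

lemma walk_bounds: "walk B bs t p W q r i j y \<Longrightarrow> 0 < W \<and> W \<le> B \<and> p \<le> length bs"
  by (cases rule: walk.cases) auto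

lemma walk_Suc: "walk B bs t p W q r i j y \<Longrightarrow> walk B bs (Suc t) p W q r i j y"
  by (induction rule: walk.induct) (auto intro: walk.intros)

lemma walk_mono: "walk B bs t p W q r i j y \<Longrightarrow> t \<le> t' \<Longrightarrow> walk B bs t' p W q r i j y"
  by (induction t') (auto simp: le_Suc_eq intro: walk_Suc)

text \<open>The run of zeros makes the width self-delimiting in constant time: if \<open>x\<close> is the first word, then
  \<open>x XOR (x - 1)\<close> is a mask of \<open>W + 1\<close> bits.\<close>

definition header :: "nat \<Rightarrow> bool list" where
  "header W = replicate W False @ True # map (bit W) [0..<Suc W]"

text \<open>The search begins at position 0 with \<open>q = w\<close> and \<open>r = 0\<close>: both
  quotients vanish, so the root record is read whatever the size of the matrix. Before that,
  register 5 serves for the constant 2 in the header length \<open>2 * W + 2\<close>.\<close>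

definition prologue :: "instr list" where
  "prologue =
    [Const 8 1, Const 9 6, WordSize 11, Load 12 2, Binop Sub 13 12 8, Binop Xor 13 12 13,
     Binop Add 14 13 8, Binop Div 12 12 14, Binop And 4 12 13,
     Binop Add 7 4 4, Const 5 2, Binop Add 7 7 5, WordSize 5]"

definition body :: "instr list" where
  "body = body_index @ body_read @ body_fields"

definition query_prog :: "instr list" where
  "query_prog = prologue @ body @ [JumpLess 10 4 13, Binop Add 0 2 10, Halt]"

lemma length_body: "length body = 39" and length_prologue: "length prologue = 13"
  by (simp_all add: body_def body_index_def body_read_def body_fields_def prologue_def)

lemma run_body:
  assumes R: "R 0 = i" "R 1 = j" "R 2 = v" "R 3 = p" "R 4 = W" "R 5 = q" "R 6 = r" "R 7 = H"
      "R 8 = 1" "R 9 = 6" "R 10 = 0" "R 11 = w"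
    and us: "length us = H" "length (us @ bs) < 2 ^ w"
    and w: "0 < W" "6 * W \<le> w" "i < 2 ^ w" "j < 2 ^ w"
    and a: "a = p + 6 * W * (i div 2 ^ q * 2 ^ r + j div 2 ^ q)" "a + 6 * W \<le> length bs"
    and v: "v + fld bs a W < 2 ^ w"
    and p: "fld bs (a + 5 * W) W \<noteq> 0 \<Longrightarrow> fld bs (a + W) W * p + fld bs (a + 2 * W) W < 2 ^ w"
  obtains R' where "run w query_prog 39 \<lparr>pc = 13, regs = R, mem = pack w (us @ bs)\<rparr> =
      Some \<lparr>pc = 52, regs = R', mem = pack w (us @ bs)\<rparr>"
    "R' 0 = i mod 2 ^ q" "R' 1 = j mod 2 ^ q" "R' 2 = v + fld bs a W"
    "fld bs (a + 5 * W) W \<noteq> 0 \<longrightarrow> R' 3 = fld bs (a + W) W * p + fld bs (a + 2 * W) W"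
    "R' 4 = fld bs (a + 5 * W) W" "R' 5 = fld bs (a + 3 * W) W" "R' 6 = fld bs (a + 4 * W) W"
    "R' 7 = H" "R' 8 = 1" "R' 9 = 6" "R' 10 = 0" "R' 11 = w"
proof -
  let ?M = "pack w (us @ bs)"
  have w0: "0 < w" using w by simp
  have ww: "w < 2 ^ w" by simp
  have Ha: "H + p + 6 * W * (i div 2 ^ q * 2 ^ r + j div 2 ^ q) = H + a" using a by simp
  have Ha2: "H + a < 2 ^ w" using us a(2) by simp
  have "\<exists>R'. exec w ?M body_index R = Some R' \<and> R' 0 = i mod 2 ^ q \<and> R' 1 = j mod 2 ^ q \<and>
           R' 12 = H + a \<and> R' 14 = 6 * W \<and> (\<forall>k. k \<in> {2,3,4,5,6,7,8,9,10,11} \<longrightarrow> R' k = R k)"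
    unfolding Ha[symmetric]
    by (rule exec_index[OF R(1,2,4,5,6,7,8,9,10) w0 w(3,4,1)]) (use Ha Ha2 w(2) ww in linarith)+
  then obtain R1 where R1: "exec w ?M body_index R = Some R1" "R1 0 = i mod 2 ^ q" "R1 1 = j mod 2 ^ q"
      "R1 12 = H + a" "R1 14 = 6 * W" "\<And>k. k \<in> {2,3,4,5,6,7,8,9,10,11} \<Longrightarrow> R1 k = R k"
    by blast
  have "\<exists>R'. exec w ?M body_read R1 = Some R' \<and> take_bit (6 * W) (R' 12) = fld (us @ bs) (H + a) (6 * W) \<and>
           (\<forall>k. k \<notin> {12,13,14,15} \<longrightarrow> R' k = R1 k)"
  proof (rule exec_read[OF R1(4,5)])
    show "R1 11 = w" "R1 8 = 1" using R R1(6) by simp_all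
    show "H + a + 6 * W \<le> length (us @ bs)" using us(1) a(2) by simp
  qed (use w0 w(1,2) us in simp_all)
  then obtain R2 where R2: "exec w ?M body_read R1 = Some R2" "take_bit (6 * W) (R2 12) = fld (us @ bs) (H + a) (6 * W)"
      "\<And>k. k \<notin> {12,13,14,15} \<Longrightarrow> R2 k = R1 k" by blast
  have fl': "fld (us @ bs) (H + b) l = fld bs b l" for b l using us fld_drop[of us bs] by simp
  have "\<exists>R'. exec w ?M body_fields R2 = Some R' \<and> R' 2 = v + fld bs a W \<and>
           (fld bs (a + 5 * W) W \<noteq> 0 \<longrightarrow> R' 3 = fld bs (a + W) W * p + fld bs (a + 2 * W) W) \<and>
           R' 5 = fld bs (a + 3 * W) W \<and> R' 6 = fld bs (a + 4 * W) W \<and> R' 4 = fld bs (a + 5 * W) W \<and>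
           (\<forall>k. k \<in> {0,1,7,8,9,10,11} \<longrightarrow> R' k = R2 k)"
  proof (rule exec_fields)
    show "R2 2 = v" "R2 3 = p" "R2 4 = W" "R2 8 = 1"
      using R R1(6) R2(3) by simp_all
    show "take_bit (6 * W) (R2 12) = fld bs a (6 * W)" unfolding R2(2) fl' ..
    show "W < w" using w by simp
  qed (fact w0 v p)+
  then obtain R3 where R3: "exec w ?M body_fields R2 = Some R3" "R3 2 = v + fld bs a W"
      "fld bs (a + 5 * W) W \<noteq> 0 \<longrightarrow> R3 3 = fld bs (a + W) W * p + fld bs (a + 2 * W) W"
      "R3 5 = fld bs (a + 3 * W) W" "R3 6 = fld bs (a + 4 * W) W" "R3 4 = fld bs (a + 5 * W) W"
      "\<And>k. k \<in> {0,1,7,8,9,10,11} \<Longrightarrow> R3 k = R2 k" by blast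
  have "exec w ?M body R = Some R3" using R1 R2 R3 by (simp add: body_def exec_append)
  from run_exec[OF this, of prologue "[JumpLess 10 4 13, Binop Add 0 2 10, Halt]"]
  have run: "run w query_prog 39 \<lparr>pc = 13, regs = R, mem = ?M\<rparr> = Some \<lparr>pc = 52, regs = R3, mem = ?M\<rparr>"
    by (simp add: query_prog_def length_body length_prologue)
  show ?thesis
    by (rule that[OF run]) (use R R1 R2 R3 in simp_all)
qed

section \<open>Running the complete query\<close>

lemma query_prog_nth: "query_prog ! 52 = JumpLess 10 4 13" "query_prog ! 53 = Binop Add 0 2 10"
    "query_prog ! 54 = Halt" "length query_prog = 55"
  by (simp_all add: query_prog_def nth_append length_body length_prologue)

text \<open>A level costs the 39 instructions of \<open>body\<close> and one jump; the additional 1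
  is the final copy into register 0.\<close>

lemma run_walk:
  assumes "walk B bs t p W q r i j y"
    and "R 0 = i" "R 1 = j" "R 2 = v" "R 3 = p" "R 4 = W" "R 5 = q" "R 6 = r" "R 7 = H"
      "R 8 = 1" "R 9 = 6" "R 10 = 0" "R 11 = w"
    and us: "length us = H" "length (us @ bs) < 2 ^ w" "6 * B \<le> w"
    and "i < 2 ^ w" "j < 2 ^ w" "v + y < 2 ^ w"
  shows "\<exists>t' R'. t' \<le> 40 * t + 1 \<and>
     run w query_prog t' \<lparr>pc = 13, regs = R, mem = pack w (us @ bs)\<rparr> =
      Some \<lparr>pc = 54, regs = R', mem = pack w (us @ bs)\<rparr> \<and> R' 0 = v + y"
  using assms(1-13,17-)
proof (induction arbitrary: R v rule: walk.induct)
  case (stop W a p i q r j y t)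
  let ?M = "pack w (us @ bs)"
  have W: "6 * W \<le> w" using stop.hyps us by simp
  have v: "v + fld bs a W < 2 ^ w" using stop by simp
  obtain R' where R': "run w query_prog 39 \<lparr>pc = 13, regs = R, mem = ?M\<rparr> =
      Some \<lparr>pc = 52, regs = R', mem = ?M\<rparr>" "R' 2 = v + fld bs a W" "R' 4 = 0" "R' 10 = 0"
    by (rule run_body[OF stop.prems(1-12) us(1,2) stop.hyps(1) W stop.prems(13,14) stop.hyps(3,4) v])
      (use stop.hyps(5) in simp_all)
  have "step w query_prog \<lparr>pc = 52, regs = R', mem = ?M\<rparr> = Some \<lparr>pc = 53, regs = R', mem = ?M\<rparr>"
    using R'(3,4) by (simp add: step_def query_prog_nth)
  moreover have "step w query_prog \<lparr>pc = 53, regs = R', mem = ?M\<rparr> =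
      Some \<lparr>pc = 54, regs = R'(0 := v + y), mem = ?M\<rparr>"
    using R'(2,4) v stop.hyps(6) by (simp add: step_def query_prog_nth set_reg_def take_bit_idem_nat)
  ultimately have "run w query_prog (39 + (Suc (Suc 0))) \<lparr>pc = 13, regs = R, mem = ?M\<rparr> =
      Some \<lparr>pc = 54, regs = R'(0 := v + y), mem = ?M\<rparr>"
    unfolding run_add R'(1) by simp
  then show ?case by (intro exI[of _ 41] exI[of _ "R'(0 := v + y)"]) (simp del: run.simps fun_upd_apply, simp)
next
  case (down W a p i q r j t y' y)
  let ?M = "pack w (us @ bs)"
  have W: "6 * W \<le> w" using down.hyps us by simp
  have v: "v + fld bs a W < 2 ^ w" using down.prems down.hyps by simp
  note b = walk_bounds[OF down.hyps(5)]
  have p: "fld bs (a + W) W * p + fld bs (a + 2 * W) W < 2 ^ w" using b us by simp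
  obtain R' where R': "run w query_prog 39 \<lparr>pc = 13, regs = R, mem = ?M\<rparr> =
      Some \<lparr>pc = 52, regs = R', mem = ?M\<rparr>"
    "R' 0 = i mod 2 ^ q" "R' 1 = j mod 2 ^ q" "R' 2 = v + fld bs a W"
    "fld bs (a + 5 * W) W \<noteq> 0 \<longrightarrow> R' 3 = fld bs (a + W) W * p + fld bs (a + 2 * W) W"
    "R' 4 = fld bs (a + 5 * W) W" "R' 5 = fld bs (a + 3 * W) W" "R' 6 = fld bs (a + 4 * W) W"
    "R' 7 = H" "R' 8 = 1" "R' 9 = 6" "R' 10 = 0" "R' 11 = w"
    by (rule run_body[OF down.prems(1-12) us(1,2) down.hyps(1) W down.prems(13,14) down.hyps(3,4) v p])
  have ij: "i mod 2 ^ q < 2 ^ w" "j mod 2 ^ q < 2 ^ w"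
    using down.prems by (meson le_less_trans mod_less_eq_dividend)+
  have "v + fld bs a W + y' < 2 ^ w" using down.prems down.hyps by simp
  from down.IH[OF R'(2,3,4) _ R'(6-) ij this] R'(5) b
  have "\<exists>t' R2. t' \<le> 40 * t + 1 \<and> run w query_prog t' \<lparr>pc = 13, regs = R', mem = ?M\<rparr> =
     Some \<lparr>pc = 54, regs = R2, mem = ?M\<rparr> \<and> R2 0 = v + fld bs a W + y'" by simp
  then obtain t' R2 where t': "t' \<le> 40 * t + 1"
     "run w query_prog t' \<lparr>pc = 13, regs = R', mem = ?M\<rparr> = Some \<lparr>pc = 54, regs = R2, mem = ?M\<rparr>"
     "R2 0 = v + fld bs a W + y'" by blast
  have "step w query_prog \<lparr>pc = 52, regs = R', mem = ?M\<rparr> = Some \<lparr>pc = 13, regs = R', mem = ?M\<rparr>"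
    using R'(6,11) b R'(12) by (simp add: step_def query_prog_nth)
  then have "run w query_prog (39 + (Suc t')) \<lparr>pc = 13, regs = R, mem = ?M\<rparr> =
      Some \<lparr>pc = 54, regs = R2, mem = ?M\<rparr>"
    unfolding run_add R'(1) using t'(2) by simp
  then show ?case using t'(1,3) down.hyps(6)
    by (intro exI[of _ "39 + Suc t'"] exI[of _ R2]) (simp del: run.simps)
qed

text \<open>The lowest set bit of \<open>x\<close> is bit \<open>W\<close>; subtracting 1 changes
  this bit and the zeros below it and nothing else.\<close>

lemma sem_Xor_pred:
  assumes "take_bit (Suc W) x = 2 ^ W" "x < 2 ^ w"
  shows "binop_sem w Xor x (binop_sem w Sub x 1) = mask (Suc W)"
proof -
  define u where "u = drop_bit (Suc W) x"
  have x: "x = 2 ^ Suc W * u + 2 ^ W"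
    using bits_ident[of "Suc W" x] assms(1) by (simp add: u_def push_bit_eq_mult mult.commute)
  have pw: "(0::nat) < 2 ^ W" by simp
  have "1 \<le> x" using x pw by linarith
  then have s: "binop_sem w Sub x 1 = x - 1" using assms(2) sem_Sub by blast
  have x1: "x - 1 = (2 ^ W - 1) + 2 ^ Suc W * u" using x pw by linarith
  have sm: "2 ^ W - 1 < (2::nat) ^ Suc W" using pw unfolding power_Suc by linarith
  have d1: "drop_bit (Suc W) (x - 1) = u"
    unfolding x1 drop_bit_eq_div using sm by (subst div_mult_self2) auto
  have t1: "take_bit (Suc W) (x - 1) = mask W"
    unfolding x1 take_bit_eq_mod using sm by (subst mod_mult_self2) (simp add: mask_eq_exp_minus_1)
  have "semiring_bit_operations_class.xor x (x - 1) = mask (Suc W)"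
  proof (rule bit_eqI)
    fix k
    show "bit (semiring_bit_operations_class.xor x (x - 1)) k \<longleftrightarrow> bit (mask (Suc W) :: nat) k"
    proof (cases "k < Suc W")
      case True
      have "bit x k \<longleftrightarrow> bit (take_bit (Suc W) x) k" "bit (x - 1) k \<longleftrightarrow> bit (take_bit (Suc W) (x - 1)) k"
        using True by (simp_all add: bit_take_bit_iff del: take_bit_Suc)
      then show ?thesis using True unfolding assms(1) t1
        by (auto simp: bit_xor_iff bit_exp_iff bit_mask_iff)
    next
      case False
      have "bit x k \<longleftrightarrow> bit (drop_bit (Suc W) x) (k - Suc W)"
        "bit (x - 1) k \<longleftrightarrow> bit (drop_bit (Suc W) (x - 1)) (k - Suc W)"
        using False by (simp_all only: bit_drop_bit_eq o_def) simp_all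
      then show ?thesis using False unfolding d1 u_def[symmetric]
        by (simp add: bit_xor_iff bit_mask_iff)
    qed
  qed
  then show ?thesis using s by (simp del: binop_sem.simps(2))
qed

text \<open>The first assumption puts the whole header into the first word; with
  \<open>4 <= w\<close> the constants up to 6 survive truncation.\<close>

lemma run_prologue:
  assumes W: "2 * W + 2 \<le> w" "4 \<le> w"
  obtains R where "run w query_prog 13 (query_state w (header W @ bs) i j) =
      Some \<lparr>pc = 13, regs = R, mem = pack w (header W @ bs)\<rparr>"
    "R 0 = i" "R 1 = j" "R 2 = 0" "R 3 = 0" "R 4 = W" "R 5 = w" "R 6 = 0" "R 7 = length (header W)"
    "R 8 = 1" "R 9 = 6" "R 10 = 0" "R 11 = w"
proof -
  let ?M = "pack w (header W @ bs)"
  let ?R = "(\<lambda>_. 0)(0 := i, 1 := j) :: nat \<Rightarrow> nat"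
  define x where "x = fld (header W @ bs) 0 w"
  have w0: "0 < w" and ww: "w < 2 ^ w" using W by simp_all
  have lh: "length (header W) = 2 * W + 2" by (simp add: header_def)
  have m: "0 < length ?M" "?M ! 0 = x"
    using pack_nth[of w 0 "header W @ bs"] w0 lh by (simp_all add: x_def)
  have x: "x < 2 ^ w" by (simp add: x_def fld_def)
  have bx: "bit x k \<longleftrightarrow> header W ! k" if "k < 2 * W + 2" for k
    using that W lh by (simp add: x_def fld_def bit_take_bit_iff bit_bits_val nth_append)
  have low: "bit x k \<longleftrightarrow> k = W" if "k < Suc W" for k
    using bx[of k] that by (cases "k = W") (simp_all add: header_def nth_append)
  have "take_bit (Suc W) x = 2 ^ W"
  proof (rule bit_eqI)
    fix k
    show "bit (take_bit (Suc W) x) k \<longleftrightarrow> bit ((2::nat) ^ W) k"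
      by (cases "k < Suc W") (use low[of k] in \<open>auto simp: bit_take_bit_iff bit_exp_iff simp del: take_bit_Suc\<close>)
  qed
  from sem_Xor_pred[OF this x] have e1: "binop_sem w Xor x (binop_sem w Sub x 1) = mask (Suc W)" .
  have "(2::nat) ^ Suc W < 2 ^ w" using W by (intro power_strict_increasing) auto
  then have e2: "binop_sem w Add (mask (Suc W)) 1 = 2 ^ Suc W"
    by (simp add: take_bit_idem_nat mask_eq_exp_minus_1)
  have e3: "binop_sem w And (binop_sem w Div x (2 ^ Suc W)) (mask (Suc W)) = W"
  proof -
    have "binop_sem w And (binop_sem w Div x (2 ^ Suc W)) (mask (Suc W)) = take_bit (Suc W) (drop_bit (Suc W) x)"
      by (simp add: take_bit_eq_mask drop_bit_eq_div del: power_Suc take_bit_Suc mask_Suc_exp)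
    also have "\<dots> = W"
    proof (rule bit_eqI)
      fix k
      have "bit W k \<Longrightarrow> k < Suc W"
        by (metis bit_take_bit_iff less_SucI less_exp take_bit_nat_eq_self_iff)
      then show "bit (take_bit (Suc W) (drop_bit (Suc W) x)) k \<longleftrightarrow> bit W k"
        by (auto simp: bit_take_bit_iff bit_drop_bit_eq bx header_def nth_append
            simp del: take_bit_Suc upt_Suc)
    qed
    finally show ?thesis .
  qed
  have e4: "binop_sem w Add W W = 2 * W" "binop_sem w Add (2 * W) 2 = 2 * W + 2"
  proof -
    have "2 * W + 2 < 2 ^ w" using W ww by linarith
    then show "binop_sem w Add W W = 2 * W" "binop_sem w Add (2 * W) 2 = 2 * W + 2"
      by (simp_all add: take_bit_idem_nat mult_2)
  qed
  have t: "take_bit w 1 = (1::nat)" "take_bit w 6 = (6::nat)" "take_bit w 2 = (2::nat)" "take_bit w w = w"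
    using assms power_increasing[of 4 w "2::nat"] ww by (simp_all add: take_bit_idem_nat)
  have "\<exists>R. exec w ?M prologue ?R = Some R \<and> R 0 = i \<and> R 1 = j \<and> R 2 = 0 \<and> R 3 = 0 \<and> R 4 = W \<and> R 5 = w \<and>
     R 6 = 0 \<and> R 7 = 2 * W + 2 \<and> R 8 = 1 \<and> R 9 = 6 \<and> R 10 = 0 \<and> R 11 = w"
    unfolding prologue_def using m W w0
    by (simp add: t e1 e2 e3 e4 del: binop_sem.simps One_nat_def power_Suc)
  then obtain R where R: "exec w ?M prologue ?R = Some R" "R 0 = i" "R 1 = j" "R 2 = 0" "R 3 = 0" "R 4 = W" "R 5 = w"
    "R 6 = 0" "R 7 = 2 * W + 2" "R 8 = 1" "R 9 = 6" "R 10 = 0" "R 11 = w" by auto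
  from run_exec[OF R(1), of "[]" "body @ [JumpLess 10 4 13, Binop Add 0 2 10, Halt]"]
  have run: "run w query_prog 13 (query_state w (header W @ bs) i j) = Some \<lparr>pc = 13, regs = R, mem = ?M\<rparr>"
    by (simp add: query_prog_def length_prologue query_state_def)
  show ?thesis by (rule that[OF run]) (use R lh in simp_all)
qed

lemma answers_within_walk:
  assumes walk: "\<And>i j. i < n \<Longrightarrow> j < n \<Longrightarrow> walk B bs t 0 W w 0 i j (f i j)"
    and w: "2 * W + 2 \<le> w" "4 \<le> w" "6 * B \<le> w" "length (header W @ bs) < 2 ^ w"
    and n: "n \<le> 2 ^ w" "\<And>i j. i < n \<Longrightarrow> j < n \<Longrightarrow> f i j < 2 ^ w"
    and ij: "i < n" "j < n" and T: "real (40 * t + 14) \<le> T"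
  shows "answers_within w query_prog (header W @ bs) i j (int (f i j)) T"
proof -
  obtain R where R: "run w query_prog 13 (query_state w (header W @ bs) i j) =
      Some \<lparr>pc = 13, regs = R, mem = pack w (header W @ bs)\<rparr>"
    "R 0 = i" "R 1 = j" "R 2 = 0" "R 3 = 0" "R 4 = W" "R 5 = w" "R 6 = 0" "R 7 = length (header W)"
    "R 8 = 1" "R 9 = 6" "R 10 = 0" "R 11 = w"
    using run_prologue[OF w(1,2)] by blast
  have "i < 2 ^ w" "j < 2 ^ w" "0 + f i j < 2 ^ w" using n ij by (auto intro: less_le_trans)
  from run_walk[OF walk[OF ij] R(2-) refl w(4,3) this]
  obtain t' R' where t': "t' \<le> 40 * t + 1"
     "run w query_prog t' \<lparr>pc = 13, regs = R, mem = pack w (header W @ bs)\<rparr> =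
      Some \<lparr>pc = 54, regs = R', mem = pack w (header W @ bs)\<rparr>" "R' 0 = f i j" by auto
  have "run w query_prog (13 + t') (query_state w (header W @ bs) i j) =
      Some \<lparr>pc = 54, regs = R', mem = pack w (header W @ bs)\<rparr>"
    unfolding run_add R(1) using t'(2) by simp
  moreover have "real (13 + t') \<le> T" using t'(1) T by simp
  ultimately show ?thesis
    unfolding answers_within_def halted_def using t'(3)
    by (intro exI[of _ "13 + t'"] exI conjI) (assumption | simp add: query_prog_nth)+
qed

section \<open>Bit layout\<close>

definition occurs_at :: "bool list \<Rightarrow> nat \<Rightarrow> bool list \<Rightarrow> bool" where
  "occurs_at bs p d \<longleftrightarrow> (\<exists>xs ys. bs = xs @ d @ ys \<and> length xs = p)"

lemma occurs_at_append:
  assumes "occurs_at bs p (d1 @ d2)"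
  shows "occurs_at bs p d1" "occurs_at bs (p + length d1) d2"
proof -
  obtain xs ys where *: "bs = xs @ (d1 @ d2) @ ys" "length xs = p"
    using assms by (auto simp: occurs_at_def)
  show "occurs_at bs p d1" using * unfolding occurs_at_def
    by (intro exI[of _ xs] exI[of _ "d2 @ ys"]) simp
  show "occurs_at bs (p + length d1) d2" using * unfolding occurs_at_def
    by (intro exI[of _ "xs @ d1"] exI[of _ ys]) simp
qed

lemma length_concat_upt: "length (concat (map D [0..<n])) = (\<Sum>l<n. length (D l))"
  by (induction n) auto

lemma occurs_at_concat:
  assumes "occurs_at bs p (concat (map D [0..<n]))" "k < n"
  shows "occurs_at bs (p + (\<Sum>l<k. length (D l))) (D k)"
  using assms
proof (induction n)
  case (Suc n)
  have "occurs_at bs p (concat (map D [0..<n]) @ D n)" using Suc.prems by simp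
  from occurs_at_append[OF this] show ?case
    using Suc by (cases "k = n") (auto simp: length_concat_upt)
qed simp

lemma occurs_at_length: "occurs_at bs p d \<Longrightarrow> p + length d \<le> length bs"
  by (auto simp: occurs_at_def)

definition enc :: "nat \<Rightarrow> nat \<Rightarrow> bool list" where
  "enc W x = map (bit x) [0..<W]"

lemma length_enc: "length (enc W x) = W"
  by (simp add: enc_def)

lemma fld_enc:
  assumes "occurs_at bs p (enc W x)" "x < 2 ^ W"
  shows "fld bs p W = x"
proof -
  obtain xs ys where *: "bs = xs @ (enc W x @ ys)" "length xs = p"
    using assms by (auto simp: occurs_at_def)
  have "fld bs p W = fld (enc W x @ ys) 0 W" using fld_drop[of xs _ 0] * by simp
  also have "\<dots> = take_bit W x"
    by (rule bit_eqI) (auto simp: fld_def bit_take_bit_iff bit_bits_val nth_append enc_def)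
  finally show ?thesis using assms(2) by (simp add: take_bit_idem_nat)
qed

definition rec_bits :: "nat \<Rightarrow> nat \<Rightarrow> nat \<Rightarrow> nat \<Rightarrow> nat \<Rightarrow> nat \<Rightarrow> nat \<Rightarrow> bool list" where
  "rec_bits W v z pt q r W' = enc W v @ enc W z @ enc W pt @ enc W q @ enc W r @ enc W W'"

lemma length_rec_bits: "length (rec_bits W v z pt q r W') = 6 * W"
  by (simp add: rec_bits_def length_enc)

lemma fld_rec_bits:
  assumes "occurs_at bs a (rec_bits W v z pt q r W')"
  shows "v < 2 ^ W \<Longrightarrow> fld bs a W = v" "z < 2 ^ W \<Longrightarrow> fld bs (a + W) W = z"
    "pt < 2 ^ W \<Longrightarrow> fld bs (a + 2 * W) W = pt" "q < 2 ^ W \<Longrightarrow> fld bs (a + 3 * W) W = q"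
    "r < 2 ^ W \<Longrightarrow> fld bs (a + 4 * W) W = r" "W' < 2 ^ W \<Longrightarrow> fld bs (a + 5 * W) W = W'"
proof -
  note o1 = occurs_at_append[OF assms[unfolded rec_bits_def], unfolded length_enc]
  note o2 = occurs_at_append[OF o1(2), unfolded length_enc]
  note o3 = occurs_at_append[OF o2(2), unfolded length_enc]
  note o4 = occurs_at_append[OF o3(2), unfolded length_enc]
  note o5 = occurs_at_append[OF o4(2), unfolded length_enc]
  have e: "a + W + W = a + 2 * W" "a + 2 * W + W = a + 3 * W" "a + 3 * W + W = a + 4 * W"
    "a + 4 * W + W = a + 5 * W" by simp_all
  show "v < 2 ^ W \<Longrightarrow> fld bs a W = v" "z < 2 ^ W \<Longrightarrow> fld bs (a + W) W = z"
    "pt < 2 ^ W \<Longrightarrow> fld bs (a + 2 * W) W = pt" "q < 2 ^ W \<Longrightarrow> fld bs (a + 3 * W) W = q"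
    "r < 2 ^ W \<Longrightarrow> fld bs (a + 4 * W) W = r" "W' < 2 ^ W \<Longrightarrow> fld bs (a + 5 * W) W = W'"
    using o1(1) o2(1) o3(1) o4(1) o5 unfolding e by (blast intro: fld_enc)+
qed

section \<open>Ranges of the blocks of a monotone matrix\<close>

definition mono2 :: "nat \<Rightarrow> (nat \<Rightarrow> nat \<Rightarrow> nat) \<Rightarrow> bool" where
  "mono2 S f \<longleftrightarrow> (\<forall>i i' j j'. i \<le> i' \<and> i' < S \<and> j \<le> j' \<and> j' < S \<longrightarrow> f i j \<le> f i' j')"

definition range_of :: "nat \<Rightarrow> (nat \<Rightarrow> nat \<Rightarrow> nat) \<Rightarrow> nat" where
  "range_of S f = f (S - 1) (S - 1) - f 0 0"

definition block :: "(nat \<Rightarrow> nat \<Rightarrow> nat) \<Rightarrow> nat \<Rightarrow> nat \<Rightarrow> nat \<Rightarrow> nat \<Rightarrow> nat \<Rightarrow> nat" where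
  "block f e I J = (\<lambda>i j. f (I * 2 ^ e + i) (J * 2 ^ e + j))"

lemma mono2D: "mono2 S f \<Longrightarrow> i \<le> i' \<Longrightarrow> i' < S \<Longrightarrow> j \<le> j' \<Longrightarrow> j' < S \<Longrightarrow> f i j \<le> f i' j'"
  by (auto simp: mono2_def)

lemma diff_le_range_of: "mono2 S f \<Longrightarrow> i < S \<Longrightarrow> j < S \<Longrightarrow> f i j - f 0 0 \<le> range_of S f"
  unfolding range_of_def by (intro diff_le_mono mono2D[of S f]) auto

lemma range_of_0_const: "mono2 S f \<Longrightarrow> range_of S f = 0 \<Longrightarrow> i < S \<Longrightarrow> j < S \<Longrightarrow> f i j = f 0 0"
  using diff_le_range_of[of S f i j] mono2D[of S f 0 i 0 j] by simp

lemma block_index: "I * s + i < G * s" if "I < G" "i < s" for I s i G :: nat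
proof -
  have "I * s + i < Suc I * s" using that by simp
  also have "\<dots> \<le> G * s" using that by (intro mult_le_mono1) simp
  finally show ?thesis .
qed

lemma mono2_block: "mono2 (G * 2 ^ e) f \<Longrightarrow> I < G \<Longrightarrow> J < G \<Longrightarrow> mono2 (2 ^ e) (block f e I J)"
  unfolding mono2_def[of "2 ^ e"] block_def by (auto intro!: mono2D[of "G * 2 ^ e" f] block_index)

lemma range_of_block_le:
  assumes "mono2 (G * 2 ^ e) f" "I < G" "J < G"
  shows "range_of (2 ^ e) (block f e I J) \<le> range_of (G * 2 ^ e) f"
proof -
  have p: "2 ^ e - 1 < (2::nat) ^ e" by simp
  note b = block_index[OF assms(2) p] block_index[OF assms(3) p]
  then have "f (I * 2 ^ e + (2 ^ e - 1)) (J * 2 ^ e + (2 ^ e - 1)) \<le> f (G * 2 ^ e - 1) (G * 2 ^ e - 1)"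
    by (intro mono2D[OF assms(1)]) linarith+
  moreover have "f 0 0 \<le> f (I * 2 ^ e) (J * 2 ^ e)"
    using b by (intro mono2D[OF assms(1)]) linarith+
  ultimately show ?thesis unfolding range_of_def block_def add_0_right by linarith
qed

text \<open>The last entry of a block is at most the first entry of its diagonal successor. This
  diagonal difference is a vertical plus a horizontal one, and along each of the \<open>G\<close>
  columns and \<open>G\<close> rows of the grid these telescope to at most the range of the matrix.
  Hence the factor \<open>2 * G\<close> in place of \<open>G * G\<close>.\<close>

lemma sum_range_of_block:
  assumes m: "mono2 (G * 2 ^ e) f"
  shows "(\<Sum>I<G. \<Sum>J<G. range_of (2 ^ e) (block f e I J)) \<le> 2 * G * range_of (G * 2 ^ e) f"
proof (cases "G = 0")
  case False
  define S where "S = G * 2 ^ e"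
  \<comment> \<open>The corner following a block in the last row or column of the grid lies outside
    the matrix; the minimum moves it back to the border.\<close>
  define a where "a I J = int (f (min (I * 2 ^ e) (S - 1)) (min (J * 2 ^ e) (S - 1)))" for I J
  have S: "0 < S" using False by (simp add: S_def)
  have am: "a I J \<le> a I' J'" if "I \<le> I'" "J \<le> J'" for I J I' J'
  proof -
    have "I * 2 ^ e \<le> I' * 2 ^ e" "J * 2 ^ e \<le> J' * 2 ^ e" using that by simp_all
    then show ?thesis
      unfolding a_def using S by (intro of_nat_mono mono2D[OF m[folded S_def]]) linarith+
  qed
  have ar: "a I J - a I' J' \<le> int (range_of S f)" for I J I' J'
  proof -
    have "f (min (I * 2 ^ e) (S - 1)) (min (J * 2 ^ e) (S - 1)) \<le> f (S - 1) (S - 1)"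
      "f 0 0 \<le> f (min (I' * 2 ^ e) (S - 1)) (min (J' * 2 ^ e) (S - 1))"
      using S by (intro mono2D[OF m[folded S_def]]; linarith)+
    then show ?thesis unfolding a_def range_of_def by linarith
  qed
  have b: "int (range_of (2 ^ e) (block f e I J)) \<le> a (Suc I) (Suc J) - a I J" if "I < G" "J < G" for I J
  proof -
    have p: "2 ^ e - 1 < (2::nat) ^ e" by simp
    note bi = block_index[OF that(1) p] block_index[OF that(2) p]
    have Suc': "Suc I * 2 ^ e = I * 2 ^ e + 2 ^ e" "Suc J * 2 ^ e = J * 2 ^ e + 2 ^ e" by simp_all
    have pp: "(0::nat) < 2 ^ e" by simp
    have "f (I * 2 ^ e + (2 ^ e - 1)) (J * 2 ^ e + (2 ^ e - 1)) \<le>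
        f (min (Suc I * 2 ^ e) (S - 1)) (min (Suc J * 2 ^ e) (S - 1))"
      unfolding Suc' using S bi pp by (intro mono2D[OF m[folded S_def]]; unfold S_def; linarith)
    moreover have "f (min (I * 2 ^ e) (S - 1)) (min (J * 2 ^ e) (S - 1)) = f (I * 2 ^ e) (J * 2 ^ e)"
    proof -
      have "min (I * 2 ^ e) (S - 1) = I * 2 ^ e" "min (J * 2 ^ e) (S - 1) = J * 2 ^ e"
        using bi unfolding S_def by linarith+
      then show ?thesis by simp
    qed
    moreover have "f (I * 2 ^ e) (J * 2 ^ e) \<le> f (I * 2 ^ e + (2 ^ e - 1)) (J * 2 ^ e + (2 ^ e - 1))"
      using bi by (intro mono2D[OF m]) linarith+
    ultimately show ?thesis unfolding a_def range_of_def block_def by (simp add: of_nat_diff)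
  qed
  have "int (\<Sum>I<G. \<Sum>J<G. range_of (2 ^ e) (block f e I J)) \<le> (\<Sum>I<G. \<Sum>J<G. a (Suc I) (Suc J) - a I J)"
    unfolding of_nat_sum by (intro sum_mono b) auto
  also have "\<dots> = (\<Sum>I<G. \<Sum>J<G. (a (Suc I) (Suc J) - a I (Suc J)) + (a I (Suc J) - a I J))"
    by simp
  also have "\<dots> = (\<Sum>J<G. \<Sum>I<G. a (Suc I) (Suc J) - a I (Suc J)) + (\<Sum>I<G. \<Sum>J<G. a I (Suc J) - a I J)"
    unfolding sum.distrib by (subst sum.swap) simp
  also have "\<dots> = (\<Sum>J<G. a G (Suc J) - a 0 (Suc J)) + (\<Sum>I<G. a I G - a I 0)"
    by (simp only: sum_lessThan_telescope sum_lessThan_telescope[of "\<lambda>I. a I (Suc _)"])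
  also have "\<dots> \<le> of_nat (card {..<G}) * int (range_of S f) + of_nat (card {..<G}) * int (range_of S f)"
    by (intro add_mono sum_bounded_above ar)
  also have "\<dots> = int (2 * G * range_of S f)" by simp
  finally show ?thesis unfolding S_def of_nat_le_iff .
qed simp

lemma sum_lessThan_add: "(\<Sum>k<a + b. g k) = (\<Sum>k<a. g k) + (\<Sum>k<b. g (a + k))"
  for g :: "nat \<Rightarrow> 'a::comm_monoid_add"
  by (induction b) (simp_all add: add.assoc)

lemma sum_group_lessThan: "(\<Sum>k<n * h. g k) = (\<Sum>I<n. \<Sum>J<h. g (I * h + J))"
  for g :: "nat \<Rightarrow> 'a::comm_monoid_add"
proof (induction n)
  case (Suc n)
  have "Suc n * h = n * h + h" by simp
  then show ?case using Suc by (simp only: sum_lessThan_add sum.lessThan_Suc)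
qed simp

lemma sum_group2:
  "(\<Sum>I<n. \<Sum>J<n. \<Sum>I'<h. \<Sum>J'<h. g (I * h + I') (J * h + J')) = (\<Sum>I<n * h. \<Sum>J<n * h. g I J)"
  for g :: "nat \<Rightarrow> nat \<Rightarrow> 'a::comm_monoid_add"
proof -
  have "(\<Sum>J<n. \<Sum>I'<h. \<Sum>J'<h. g (I * h + I') (J * h + J')) =
      (\<Sum>I'<h. \<Sum>J<n. \<Sum>J'<h. g (I * h + I') (J * h + J'))" for I
    by (rule sum.swap)
  then show ?thesis by (simp only: sum_group_lessThan)
qed

lemma block_block:
  "e' \<le> e \<Longrightarrow> block (block f e I J) e' I' J' = block f e' (I * 2 ^ (e - e') + I') (J * 2 ^ (e - e') + J')"
proof -
  assume "e' \<le> e"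
  then have "(2::nat) ^ e = 2 ^ (e - e') * 2 ^ e'" by (simp flip: power_add)
  then show ?thesis by (simp add: block_def algebra_simps)
qed

section \<open>Grids of blocks\<close>

type_synonym node = "nat \<times> nat \<times> nat \<times> bool list"

text \<open>The data of a node may be placed anywhere, provided that \<open>pre\<close>, which contains the shared nodes,
  is at the beginning of the memory.\<close>

definition realizes ::
    "nat \<Rightarrow> bool list \<Rightarrow> nat \<Rightarrow> nat \<Rightarrow> (nat \<Rightarrow> nat \<Rightarrow> nat) \<Rightarrow> node \<Rightarrow> bool" where
  "realizes B pre t e f = (\<lambda>(W, q, r, d). \<forall>bs p i j.
     (\<exists>ys. bs = pre @ ys) \<longrightarrow> occurs_at bs p d \<longrightarrow> i < 2 ^ e \<longrightarrow> j < 2 ^ e \<longrightarrow>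
     walk B bs t p W q r i j (f i j - f 0 0))"

text \<open>Width 0 is the mark in the parent's record that ends the search. A constant block can
  use it and has no node of its own, whereas a \<open>walk\<close> exists only for positive
  width.\<close>

definition represents ::
    "nat \<Rightarrow> bool list \<Rightarrow> nat \<Rightarrow> nat \<Rightarrow> (nat \<Rightarrow> nat \<Rightarrow> nat) \<Rightarrow> node \<Rightarrow> bool" where
  "represents B pre t e f c \<longleftrightarrow>
     fst c = 0 \<and> (\<forall>i<2 ^ e. \<forall>j<2 ^ e. f i j = f 0 0) \<or> realizes B pre t e f c"

lemma realizes_walk:
  "realizes B pre t e f (W, q, r, d) \<Longrightarrow> bs = pre @ ys \<Longrightarrow> occurs_at bs p d \<Longrightarrow>
   i < 2 ^ e \<Longrightarrow> j < 2 ^ e \<Longrightarrow> walk B bs t p W q r i j (f i j - f 0 0)"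
  by (auto simp: realizes_def)

definition bits_of :: "node \<Rightarrow> bool list" where
  "bits_of c = snd (snd (snd c))"

definition fields_le :: "nat \<Rightarrow> node \<Rightarrow> bool" where
  "fields_le u = (\<lambda>(W, q, r, d). W \<le> u \<and> q \<le> u \<and> r \<le> u)"

text \<open>The node consists of its \<open>4 ^ r\<close> records followed by the data of the
  children in row-major order, addressed relative to the node. In the second alternative of
  \<open>small\<close> no record points anywhere, so \<open>W\<close> may be too short for the
  length of the node; this is how single cells are stored.\<close>

lemma realizes_grid:
  assumes g: "\<And>I J. I < 2 ^ r \<Longrightarrow> J < 2 ^ r \<Longrightarrow> represents B pre t e (block f e I J) (c I J)"
    and m: "mono2 (2 ^ (e + r)) f" and W: "0 < W" "W \<le> B" "range_of (2 ^ (e + r)) f < 2 ^ W"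
    and fits: "\<And>I J. I < 2 ^ r \<Longrightarrow> J < 2 ^ r \<Longrightarrow> fields_le u (c I J)" "u < 2 ^ W"
    and L: "L = 6 * W * 4 ^ r + (\<Sum>I<2 ^ r. \<Sum>J<2 ^ r. length (bits_of (c I J)))"
    and small: "L < 2 ^ W \<or> (\<forall>I<2 ^ r. \<forall>J<2 ^ r. fst (c I J) = 0)"
  shows "\<exists>d. realizes B pre (Suc t) (e + r) f (W, e, r, d) \<and> length d = L"
proof -
  define G :: nat where "G = 2 ^ r"
  have G0: "0 < G" by (simp add: G_def)
  have GG: "G * G = 4 ^ r" by (simp add: G_def power_mult_distrib[symmetric])
  define ck where "ck k = c (k div G) (k mod G)" for k
  define D where "D k = bits_of (ck k)" for k
  define off where "off k = 6 * W * (G * G) + (\<Sum>l<k. length (D l))" for k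
  define R where "R k = (case ck k of (W', q', r', d) \<Rightarrow>
      rec_bits W (f (k div G * 2 ^ e) (k mod G * 2 ^ e) - f 0 0) 1 (if W' = 0 then 0 else off k) q' r' W')" for k
  define d where "d = concat (map R [0..<G * G]) @ concat (map D [0..<G * G])"
  have lR: "length (R k) = 6 * W" for k by (simp add: R_def length_rec_bits split: prod.splits)
  have "(\<Sum>k<G * G. length (D k)) = (\<Sum>I<G. \<Sum>J<G. length (bits_of (c I J)))"
    unfolding sum_group_lessThan D_def ck_def using G0 by (intro sum.cong refl) simp
  then have ld: "length d = L"
    by (simp add: d_def length_concat_upt lR L GG G_def[symmetric])
  have "walk B bs (Suc t) p W e r i j (f i j - f 0 0)"
    if bs: "bs = pre @ ys" "occurs_at bs p d" and ij: "i < 2 ^ (e + r)" "j < 2 ^ (e + r)" for bs ys p i j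
  proof -
    define I where "I = i div 2 ^ e"
    define J where "J = j div 2 ^ e"
    define k where "k = I * G + J"
    have IJ: "I < G" "J < G"
      using ij by (simp_all add: I_def J_def G_def power_add less_mult_imp_div_less mult.commute)
    have k: "k < G * G" unfolding k_def using block_index[OF IJ] .
    have kd: "k div G = I" "k mod G = J" using IJ by (simp_all add: k_def)
    obtain W' q' r' d' where c: "c I J = (W', q', r', d')" by (metis prod_cases4)
    have ckk: "ck k = (W', q', r', d')" by (simp add: ck_def kd c)
    have Dk: "D k = d'" by (simp add: D_def ckk bits_of_def)
    note o = occurs_at_append[OF bs(2)[unfolded d_def]]
    have oR: "occurs_at bs (p + 6 * W * k) (R k)"
      using occurs_at_concat[OF o(1) k] by (simp add: lR mult.commute)
    have oD: "occurs_at bs (p + off k) d'"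
      using occurs_at_concat[OF o(2) k] by (simp add: length_concat_upt lR off_def Dk add_ac mult_ac)
    have Rk: "R k = rec_bits W (f (I * 2 ^ e) (J * 2 ^ e) - f 0 0) 1 (if W' = 0 then 0 else off k) q' r' W'"
      by (simp add: R_def ckk kd)
    have bI: "I * 2 ^ e + (i mod 2 ^ e) = i" "J * 2 ^ e + (j mod 2 ^ e) = j"
      unfolding I_def J_def by (rule div_mult_mod_eq)+
    have Ii: "I * 2 ^ e \<le> i" "J * 2 ^ e \<le> j" using bI by linarith+
    have v: "f (I * 2 ^ e) (J * 2 ^ e) - f 0 0 < 2 ^ W"
      using diff_le_range_of[OF m, of "I * 2 ^ e" "J * 2 ^ e"] Ii ij W(3) by simp
    have f00: "f 0 0 \<le> f (I * 2 ^ e) (J * 2 ^ e)" "f (I * 2 ^ e) (J * 2 ^ e) \<le> f i j"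
      using Ii ij by (auto intro!: mono2D[OF m])
    have fit: "W' < 2 ^ W" "q' < 2 ^ W" "r' < 2 ^ W"
      using fits(1)[OF IJ[unfolded G_def]] fits(2) by (auto simp: c fields_le_def)
    have one: "1 < (2::nat) ^ W" using W(1) one_less_power[of "2::nat" W] by simp
    note F = fld_rec_bits[OF oR[unfolded Rk]]
    have e1: "p + 6 * W * (i div 2 ^ e * 2 ^ r + j div 2 ^ e) = p + 6 * W * k"
      by (simp add: k_def I_def J_def G_def)
    have len: "p + 6 * W * k + 6 * W \<le> length bs" using occurs_at_length[OF oR] by (simp add: lR)
    have mm: "i mod 2 ^ e < 2 ^ e" "j mod 2 ^ e < 2 ^ e" by simp_all
    from g[OF IJ[unfolded G_def]] consider
        "W' = 0" "\<forall>i<2 ^ e. \<forall>j<2 ^ e. block f e I J i j = block f e I J 0 0"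
      | "realizes B pre t e (block f e I J) (W', q', r', d')"
      by (auto simp: represents_def c)
    then show ?thesis
    proof cases
      case 1
      have "f i j = f (I * 2 ^ e) (J * 2 ^ e)" using 1(2)[rule_format, OF mm] by (simp add: block_def bI)
      then show ?thesis
        using F(1)[OF v] F(6)[OF fit(1)] 1 len
        by (intro walk.stop[OF W(1,2) e1[symmetric]]) simp_all
    next
      case 2
      have w: "walk B bs t (p + off k) W' q' r' (i mod 2 ^ e) (j mod 2 ^ e)
          (block f e I J (i mod 2 ^ e) (j mod 2 ^ e) - block f e I J 0 0)"
        by (rule realizes_walk[OF 2 bs(1) oD mm])
      have W': "W' \<noteq> 0" using walk_bounds[OF w] by simp
      have "off k \<le> L"
      proof -
        have "off k + length d' \<le> length d"
          using k sum_mono2[of "{..<G * G}" "{..<Suc k}" "\<lambda>l. length (D l)"]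
          by (simp add: off_def d_def length_concat_upt lR Dk lessThan_Suc subset_eq mult_ac)
        then show ?thesis using ld by simp
      qed
      moreover have "fst (c I J) \<noteq> 0" using W' c by simp
      ultimately have "off k < 2 ^ W" using small IJ unfolding G_def by (meson le_less_trans)
      then show ?thesis
        using F(1)[OF v] F(2)[OF one] F(3) F(4)[OF fit(2)] F(5)[OF fit(3)] F(6)[OF fit(1)] w W' len
        by (intro walk.down[OF W(1,2) e1[symmetric]])
          (simp_all add: block_def bI add.commute, use f00 in linarith)
    qed
  qed
  then have "realizes B pre (Suc t) (e + r) f (W, e, r, d)" by (auto simp: realizes_def)
  then show ?thesis using ld by blast
qed

section \<open>The recursive structure\<close>

definition bit_len :: "nat \<Rightarrow> nat" where
  "bit_len x = (LEAST k. x < 2 ^ k)"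

lemma less_bit_len: "x < 2 ^ bit_len x"
  unfolding bit_len_def by (rule LeastI[of _ x]) simp

lemma bit_len_le: "x < 2 ^ k \<Longrightarrow> bit_len x \<le> k"
  unfolding bit_len_def by (rule Least_le)

lemma bit_len_mono: "x \<le> y \<Longrightarrow> bit_len x \<le> bit_len y"
  using less_bit_len[of y] by (intro bit_len_le) simp

lemma bit_len_le_self: "bit_len x \<le> x"
  by (intro bit_len_le) simp

lemma bit_len_pos: "0 < x \<Longrightarrow> 0 < bit_len x"
  using less_bit_len[of x] by (cases "bit_len x") auto

lemma bit_len_pow: "0 < x \<Longrightarrow> 2 ^ bit_len x \<le> 2 * x"
proof -
  assume "0 < x"
  then obtain k where k: "bit_len x = Suc k" using bit_len_pos by (metis gr0_implies_Suc)
  then have "\<not> x < 2 ^ k" using bit_len_le by force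
  then show ?thesis using k by simp
qed

fun depth :: "nat \<Rightarrow> nat" where
  "depth e = (if e = 0 then 0 else Suc (depth (3 * e div 4)))"

declare depth.simps [simp del]

text \<open>A bound on the length of the data. The constant is 48 * 32: a record has six fields of
  width \<open>8 * (e + bit_len d)\<close> for range d, and each of the two summands contributes the
  16 of \<open>quarter_grid\<close>.\<close>

fun tree_size :: "nat \<Rightarrow> (nat \<Rightarrow> nat \<Rightarrow> nat) \<Rightarrow> nat" where
  "tree_size e f = (if e = 0 then 0 else
     1536 * 2 ^ e * range_of (2 ^ e) f +
     (\<Sum>I<2 ^ (e - 3 * e div 4). \<Sum>J<2 ^ (e - 3 * e div 4).
        tree_size (3 * e div 4) (block f (3 * e div 4) I J)))"

declare tree_size.simps [simp del]

text \<open>The induction treats all blocks of one side at once. Applied to each block separately,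
  \<open>sum_range_of_block\<close> would cost a factor 2 per level; after regrouping into one grid
  of \<open>f\<close> it is applied only once per level.\<close>

lemma sum_tree_size:
  "mono2 (G * 2 ^ e) f \<Longrightarrow>
   (\<Sum>I<G. \<Sum>J<G. tree_size e (block f e I J)) \<le> 1536 * depth e * 2 ^ e * (2 * G * range_of (G * 2 ^ e) f)"
proof (induction e arbitrary: G rule: less_induct)
  case (less e)
  show ?case
  proof (cases "e = 0")
    case False
    define e' where "e' = 3 * e div 4"
    define H :: nat where "H = 2 ^ (e - e')"
    have e': "e' < e" using False by (simp add: e'_def)
    have p: "(2::nat) ^ e = H * 2 ^ e'" using e' by (simp add: H_def flip: power_add)
    have "(\<Sum>I<G. \<Sum>J<G. tree_size e (block f e I J)) =
        1536 * 2 ^ e * (\<Sum>I<G. \<Sum>J<G. range_of (2 ^ e) (block f e I J)) +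
        (\<Sum>I<G. \<Sum>J<G. \<Sum>I'<H. \<Sum>J'<H. tree_size e' (block (block f e I J) e' I' J'))"
      using False by (subst tree_size.simps) (simp add: sum.distrib sum_distrib_left e'_def H_def)
    also have "(\<Sum>I<G. \<Sum>J<G. \<Sum>I'<H. \<Sum>J'<H. tree_size e' (block (block f e I J) e' I' J')) =
        (\<Sum>I<G * H. \<Sum>J<G * H. tree_size e' (block f e' I J))"
      using e' unfolding sum_group2[symmetric] by (simp add: block_block H_def)
    also have "\<dots> \<le> 1536 * depth e' * 2 ^ e' * (2 * (G * H) * range_of (G * H * 2 ^ e') f)"
      using less.prems by (intro less.IH e') (simp add: p mult.assoc)
    \<comment> \<open>Grid side times block side is always \<open>G * 2 ^ e\<close>, so all levels
      have the same bound.\<close>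
    also have "\<dots> = 1536 * depth e' * 2 ^ e * (2 * G * range_of (G * 2 ^ e) f)"
      by (simp add: p mult_ac)
    also have "1536 * 2 ^ e * (\<Sum>I<G. \<Sum>J<G. range_of (2 ^ e) (block f e I J)) \<le>
        1536 * 2 ^ e * (2 * G * range_of (G * 2 ^ e) f)"
      using sum_range_of_block[OF less.prems] by simp
    also have "depth e = Suc (depth e')" using False by (subst depth.simps) (simp add: e'_def)
    ultimately show ?thesis by (simp add: algebra_simps)
  qed (simp add: tree_size.simps)
qed

lemma block_0: "block f e 0 0 = f"
  by (simp add: block_def)

lemma depth_le: "depth e \<le> e"
proof (induction e rule: less_induct)
  case (less e)
  have "e \<noteq> 0 \<Longrightarrow> 3 * e div 4 < e" by linarith
  then show ?case using less[of "3 * e div 4"] by (subst depth.simps) (cases "e = 0"; simp)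
qed

lemma tree_size_le:
  assumes "mono2 (2 ^ e) f"
  shows "tree_size e f \<le> 3072 * depth e * 2 ^ e * range_of (2 ^ e) f"
  using sum_tree_size[of 1 e f] assms by (simp add: block_0)

text \<open>The grid exponent is \<open>e / 4\<close> rounded up, so there are about
  \<open>2 ^ (e / 2)\<close> blocks, and the other half of \<open>2 ^ e\<close> absorbs the factor
  \<open>e\<close>.\<close>

lemma quarter_grid: "4 ^ (e - 3 * e div 4) * e \<le> 16 * 2 ^ e"
proof (cases "e = 0")
  case False
  define a where "a = (e - 1) div 4"
  have a: "4 * a + 1 \<le> e" "e \<le> 4 * a + 4" using False unfolding a_def by linarith+
  have r: "e - 3 * e div 4 \<le> a + 1" using a by linarith
  have "a + 1 \<le> 4 ^ a" using less_exp[of a] power_mono[of 2 "4::nat" a] by linarith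
  have "4 ^ (e - 3 * e div 4) * e \<le> 4 ^ (a + 1) * (4 * (a + 1))"
    using a r by (intro mult_mono power_increasing) auto
  also have "\<dots> \<le> 4 ^ (a + 1) * (4 * 4 ^ a)" using \<open>a + 1 \<le> 4 ^ a\<close> by simp
  also have "\<dots> = 16 * 2 ^ (4 * a)" by (simp add: power_mult power_mult_distrib[symmetric])
  also have "\<dots> \<le> 16 * 2 ^ e" using a by simp
  finally show ?thesis .
qed simp

lemma represents_tree:
  assumes "mono2 (2 ^ e) f" "8 * (e + bit_len (range_of (2 ^ e) f)) \<le> B"
  shows "\<exists>c. represents B pre (depth e) e f c \<and> length (bits_of c) \<le> tree_size e f \<and>
    fields_le (8 * (e + bit_len (range_of (2 ^ e) f))) c"
  using assms
proof (induction e arbitrary: f rule: less_induct)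
  case (less e)
  define x where "x = range_of (2 ^ e) f"
  show ?case
  proof (cases "x = 0")
    case True
    then have "represents B pre (depth e) e f (0, 0, 0, [])"
      unfolding represents_def x_def by (auto intro: range_of_0_const[OF less.prems(1)])
    then show ?thesis by (intro exI[of _ "(0, 0, 0, [])"]) (simp add: bits_of_def fields_le_def)
  next
    case False
    \<comment> \<open>A single cell has range 0, so the recursion ends in the constant case.\<close>
    have "e = 0 \<Longrightarrow> x = 0" by (simp add: x_def range_of_def)
    then have e: "e \<noteq> 0" using False by blast
    define e' where "e' = 3 * e div 4"
    define r where "r = e - e'"
    \<comment> \<open>Offsets are bounded by the size of the node, which is below
      \<open>2 ^ (12 + e + e + bit_len x)\<close>; the factor 8 covers this exponent once
      \<open>e\<close> and \<open>bit_len x\<close> are positive.\<close>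
    define W where "W = 8 * (e + bit_len x)"
    have e': "e' < e" "e' + r = e" using e by (simp_all add: e'_def r_def)
    have p: "2 ^ r * 2 ^ e' = (2::nat) ^ e" unfolding e'(2)[symmetric] power_add by (rule mult.commute)
    have m: "mono2 (2 ^ r * 2 ^ e') f" using less.prems by (simp add: p)
    define child where "child I J c \<longleftrightarrow> represents B pre (depth e') e' (block f e' I J) c \<and>
        length (bits_of c) \<le> tree_size e' (block f e' I J) \<and> fields_le W c" for I J c
    define c where "c I J = (SOME c. child I J c)" for I J
    have "child I J (c I J)"
      if "I < 2 ^ r" "J < 2 ^ r" for I J
    proof -
      have "range_of (2 ^ e') (block f e' I J) \<le> x" using range_of_block_le[OF m that] by (simp add: p x_def)
      then have le: "8 * (e' + bit_len (range_of (2 ^ e') (block f e' I J))) \<le> W"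
        using e'(1) bit_len_mono[of _ x] unfolding W_def
        by (intro mult_le_mono2 add_mono) simp_all
      then have "8 * (e' + bit_len (range_of (2 ^ e') (block f e' I J))) \<le> B"
        using less.prems(2) unfolding W_def x_def by linarith
      from less.IH[OF e'(1) mono2_block[OF m that] this]
      obtain c where c: "represents B pre (depth e') e' (block f e' I J) c"
        "length (bits_of c) \<le> tree_size e' (block f e' I J)"
        "fields_le (8 * (e' + bit_len (range_of (2 ^ e') (block f e' I J)))) c" by blast
      have "fields_le W c" using c(3) le by (auto simp: fields_le_def split: prod.splits)
      with c have "child I J c" by (simp add: child_def)
      then show ?thesis unfolding c_def by (rule someI)
    qed
    then have c: "\<And>I J. I < 2 ^ r \<Longrightarrow> J < 2 ^ r \<Longrightarrow> represents B pre (depth e') e' (block f e' I J) (c I J)"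
      "\<And>I J. I < 2 ^ r \<Longrightarrow> J < 2 ^ r \<Longrightarrow> length (bits_of (c I J)) \<le> tree_size e' (block f e' I J)"
      "\<And>I J. I < 2 ^ r \<Longrightarrow> J < 2 ^ r \<Longrightarrow> fields_le W (c I J)"
      by (simp_all add: child_def)
    define L where "L = 6 * W * 4 ^ r + (\<Sum>I<2 ^ r. \<Sum>J<2 ^ r. length (bits_of (c I J)))"
    have top: "6 * W * 4 ^ r \<le> 1536 * 2 ^ e * x"
    proof -
      have q: "4 ^ r * e \<le> 16 * 2 ^ e" using quarter_grid[of e] by (simp add: r_def e'_def)
      have "4 ^ r \<le> 4 ^ r * e" using e by simp
      then have "4 ^ r * bit_len x \<le> 16 * 2 ^ e * x"
        by (intro mult_le_mono[OF order.trans[OF _ q] bit_len_le_self])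
      moreover have "4 ^ r * e \<le> 16 * 2 ^ e * x"
        using order.trans[OF q, of "16 * 2 ^ e * x"] False by simp
      ultimately have "4 ^ r * (e + bit_len x) \<le> 32 * 2 ^ e * x" by (simp add: distrib_left)
      then have "48 * (4 ^ r * (e + bit_len x)) \<le> 48 * (32 * 2 ^ e * x)" by (rule mult_le_mono2)
      then show ?thesis unfolding W_def by (simp add: algebra_simps)
    qed
    have LT: "L \<le> tree_size e f"
    proof -
      have "(\<Sum>I<2 ^ r. \<Sum>J<2 ^ r. length (bits_of (c I J))) \<le> (\<Sum>I<2 ^ r. \<Sum>J<2 ^ r. tree_size e' (block f e' I J))"
        by (intro sum_mono c) auto
      moreover have "tree_size e f = 1536 * 2 ^ e * x + (\<Sum>I<2 ^ r. \<Sum>J<2 ^ r. tree_size e' (block f e' I J))"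
        using e by (subst tree_size.simps) (simp add: e'_def r_def x_def)
      ultimately show ?thesis using top unfolding L_def by linarith
    qed
    have b1: "1 \<le> bit_len x" using bit_len_pos[of x] False by linarith
    have "tree_size e f < 2 ^ W"
    proof -
      have "tree_size e f \<le> 3072 * depth e * 2 ^ e * x" using tree_size_le[OF less.prems(1)] by (simp add: x_def)
      also have "\<dots> \<le> 2 ^ 12 * 2 ^ e * 2 ^ e * x"
        using order.trans[OF depth_le less_imp_le[OF less_exp]] by (intro mult_mono) auto
      also have "\<dots> < 2 ^ 12 * 2 ^ e * 2 ^ e * 2 ^ bit_len x" using less_bit_len[of x] by simp
      also have "\<dots> = 2 ^ (12 + e + e + bit_len x)" by (simp only: power_add)
      also have "\<dots> \<le> 2 ^ W" using b1 e unfolding W_def by (intro power_increasing) auto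
      finally show ?thesis .
    qed
    then have small: "L < 2 ^ W" using LT by simp
    have "\<exists>d. realizes B pre (Suc (depth e')) (e' + r) f (W, e', r, d) \<and> length d = L"
    proof (rule realizes_grid[where c = c and u = W])
      show "mono2 (2 ^ (e' + r)) f" using less.prems e' by simp
      show "W \<le> B" using less.prems(2) by (simp add: W_def x_def)
      show "0 < W" using e by (simp add: W_def)
      have "x < 2 ^ bit_len x" by (rule less_bit_len)
      also have "\<dots> \<le> 2 ^ W" by (intro power_increasing) (auto simp: W_def)
      finally show "range_of (2 ^ (e' + r)) f < 2 ^ W" using e' by (simp add: x_def)
      show "L = 6 * W * 4 ^ r + (\<Sum>I<2 ^ r. \<Sum>J<2 ^ r. length (bits_of (c I J)))" by (rule L_def)
      show "W < 2 ^ W" by simp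
    qed (use c small in blast)+
    then obtain d where d: "realizes B pre (Suc (depth e')) e f (W, e', r, d)" "length d = L"
      using e' by auto
    moreover have "depth e = Suc (depth e')" using e by (subst depth.simps) (simp add: e'_def)
    ultimately show ?thesis using e' LT
      by (intro exI[of _ "(W, e', r, d)"])
        (auto simp: represents_def bits_of_def fields_le_def W_def x_def)
  qed
qed

section \<open>Codes of small blocks\<close>

definition col_count :: "nat \<Rightarrow> (nat \<Rightarrow> nat \<Rightarrow> nat) \<Rightarrow> nat \<Rightarrow> nat \<Rightarrow> nat" where
  "col_count s f v i = card {j. j < s \<and> v < f i j - f 0 0}"

text \<open>For each threshold \<open>v\<close>, the positions \<open>col_count s f v i + i\<close> are strictly increasing in \<open>i\<close> and below
  \<open>2 * s\<close>. Rows with \<open>col_count s f v i = 0\<close> are omitted, so that thresholds beyond the range contribute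
  nothing and the code of a block has length proportional to its range.\<close>

definition stairs :: "nat \<Rightarrow> (nat \<Rightarrow> nat \<Rightarrow> nat) \<Rightarrow> nat set" where
  "stairs s f = {v * (2 * s) + (col_count s f v i + i) | v i. i < s \<and> col_count s f v i \<noteq> 0}"

lemma col_count_le: "col_count s f v i \<le> s"
proof -
  have "col_count s f v i \<le> card {..<s}" unfolding col_count_def by (intro card_mono) auto
  then show ?thesis by simp
qed

lemma col_count_mono:
  assumes "mono2 s f" "i \<le> i'" "i' < s"
  shows "col_count s f v i \<le> col_count s f v i'"
proof -
  have "f i j - f 0 0 \<le> f i' j - f 0 0" if "j < s" for j
    using assms that by (intro diff_le_mono mono2D[OF assms(1)]) auto
  then show ?thesis unfolding col_count_def by (intro card_mono) (auto intro: less_le_trans)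
qed

text \<open>Rows are sorted, so the entries above the threshold are the last
  \<open>col_count s f v i\<close> ones of row \<open>i\<close>.\<close>

lemma less_iff_col_count:
  assumes m: "mono2 s f" and "i < s" "j < s"
  shows "v < f i j - f 0 0 \<longleftrightarrow> s \<le> col_count s f v i + j"
proof
  assume v: "v < f i j - f 0 0"
  have "f i j - f 0 0 \<le> f i j' - f 0 0" if "j \<le> j'" "j' < s" for j'
    using that assms by (intro diff_le_mono mono2D[OF m]) auto
  with v have "{j..<s} \<subseteq> {j. j < s \<and> v < f i j - f 0 0}" by (auto intro: less_le_trans)
  from card_mono[OF _ this] show "s \<le> col_count s f v i + j" by (simp add: col_count_def)
next
  assume a: "s \<le> col_count s f v i + j"
  show "v < f i j - f 0 0"
  proof (rule ccontr)
    assume v: "\<not> v < f i j - f 0 0"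
    have "f i j' - f 0 0 \<le> f i j - f 0 0" if "j' \<le> j" for j'
      using that assms by (intro diff_le_mono mono2D[OF m]) auto
    with v have "{j. j < s \<and> v < f i j - f 0 0} \<subseteq> {Suc j..<s}"
      by (auto simp: not_less_eq_eq[symmetric] intro: ccontr) (meson leD le_less_trans not_le)
    from card_mono[OF _ this] have "col_count s f v i \<le> s - Suc j" by (simp add: col_count_def)
    then show False using a assms by linarith
  qed
qed

lemma stairs_bounded:
  assumes "mono2 s f"
  shows "stairs s f \<subseteq> {..<2 * s * range_of s f}"
proof
  fix x assume "x \<in> stairs s f"
  then obtain v i where x: "x = v * (2 * s) + (col_count s f v i + i)" "i < s" "col_count s f v i \<noteq> 0"
    by (auto simp: stairs_def)
  from x(3) have "{j. j < s \<and> v < f i j - f 0 0} \<noteq> {}" unfolding col_count_def by (metis card.empty)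
  then obtain j where "j < s" "v < f i j - f 0 0" by blast
  then have "v < range_of s f" using diff_le_range_of[OF assms x(2), of j] by simp
  moreover have "col_count s f v i + i < 2 * s" using col_count_le[of s f v i] x(2) by simp
  ultimately show "x \<in> {..<2 * s * range_of s f}"
    unfolding x(1) using block_index[of v "range_of s f" "col_count s f v i + i" "2 * s"] by (simp add: mult_ac)
qed

text \<open>In the band of \<open>v\<close>, row \<open>i\<close> lies beyond the stated position
  iff at least \<open>s - j\<close> of its entries exceed \<open>v\<close>. Then so do all rows
  after it, which makes \<open>s - i\<close> elements; otherwise only later rows can qualify.
  Counting from the last row makes the omitted rows harmless, for they come first.\<close>

lemma less_iff_card_stairs:
  assumes m: "mono2 s f" and ij: "i < s" "j < s"
  shows "v < f i j - f 0 0 \<longleftrightarrow>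
    s - i \<le> card {x \<in> stairs s f. v * (2 * s) + (i + (s - 1 - j)) < x \<and> x < Suc v * (2 * s)}"
    (is "_ \<longleftrightarrow> s - i \<le> card ?X")
proof -
  define pos where "pos i = v * (2 * s) + (col_count s f v i + i)" for i
  have sm: "pos i < pos i'" if "i < i'" "i' < s" for i i'
    using col_count_mono[OF m, of i i' v] that by (simp add: pos_def)
  have inj: "inj_on pos {..<s}"
    by (intro inj_onI) (metis lessThan_iff less_irrefl nat_neq_iff sm)
  have fin: "finite (stairs s f)" using stairs_bounded[OF m] finite_subset by blast
  have lt: "col_count s f v' i + i < 2 * s" if "i < s" for v' i using col_count_le[of s f v' i] that by simp
  show ?thesis
  proof
    assume "v < f i j - f 0 0"
    then have a: "s \<le> col_count s f v i + j" using less_iff_col_count[OF m ij] by blast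
    have "pos ` {i..<s} \<subseteq> ?X"
    proof
      fix x assume "x \<in> pos ` {i..<s}"
      then obtain i' where i': "x = pos i'" "i \<le> i'" "i' < s" by auto
      have "col_count s f v i \<le> col_count s f v i'" using col_count_mono[OF m i'(2,3)] .
      then have "col_count s f v i' \<noteq> 0" "i + (s - 1 - j) < col_count s f v i' + i'" using a ij i' by linarith+
      then show "x \<in> ?X" using i' lt[OF i'(3), of v] by (auto simp: pos_def stairs_def)
    qed
    from card_mono[OF _ this] have "card (pos ` {i..<s}) \<le> card ?X" using fin by simp
    moreover have "card (pos ` {i..<s}) = s - i"
      by (subst card_image[OF inj_on_subset[OF inj]]) auto
    ultimately show "s - i \<le> card ?X" by simp
  next
    assume le: "s - i \<le> card ?X"
    show "v < f i j - f 0 0"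
    proof (rule ccontr)
      assume "\<not> v < f i j - f 0 0"
      then have a: "col_count s f v i + j < s" using less_iff_col_count[OF m ij] by simp
      have "?X \<subseteq> pos ` {Suc i..<s}"
      proof
        fix x assume x: "x \<in> ?X"
        then obtain v' i' where x': "x = v' * (2 * s) + (col_count s f v' i' + i')" "i' < s"
          by (auto simp: stairs_def)
        have "x div (2 * s) = v'" using lt[OF x'(2), of v'] ij by (simp add: x'(1))
        moreover have "x div (2 * s) = v" using x ij by (intro div_nat_eqI) (auto simp: mult.commute)
        ultimately have x'': "x = pos i'" by (simp add: x' pos_def)
        have "v * (2 * s) + (i + (s - 1 - j)) < x" using x by blast
        then have "pos i < x" using a ij unfolding pos_def by linarith
        then have "i < i'" using sm[of i' i] ij x'' by (metis less_asym linorder_neqE_nat)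
        then show "x \<in> pos ` {Suc i..<s}" using x'' x'(2) by auto
      qed
      from card_mono[OF _ this] have "card ?X \<le> card (pos ` {Suc i..<s})" by simp
      also have "\<dots> \<le> s - Suc i" using card_image_le[of "{Suc i..<s}" pos] by simp
      finally show False using le ij by linarith
    qed
  qed
qed

definition shape_code :: "nat \<Rightarrow> (nat \<Rightarrow> nat \<Rightarrow> nat) \<Rightarrow> nat" where
  "shape_code s f = set_encode (stairs s f)"

lemma shape_code_less:
  assumes "mono2 s f"
  shows "shape_code s f < 2 ^ (2 * s * range_of s f)"
proof -
  have "shape_code s f \<le> set_encode {..<2 * s * range_of s f}"
    unfolding shape_code_def set_encode_def by (intro sum_mono2 stairs_bounded assms) auto
  also have "\<dots> < 2 ^ (2 * s * range_of s f)"
    using mask_eq_sum_exp_nat[of "2 * s * range_of s f"] less_imp_diff_less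
    unfolding set_encode_def lessThan_def by (metis diff_Suc_less One_nat_def zero_less_numeral zero_less_power)
  finally show ?thesis .
qed

text \<open>Codes serve only as table indices and are never decoded: blocks with equal codes agree
  up to their first entry and can therefore share one table entry.\<close>

lemma shape_code_inj:
  assumes f: "mono2 s f" and g: "mono2 s g" and eq: "shape_code s f = shape_code s g"
    and ij: "i < s" "j < s"
  shows "f i j - f 0 0 = g i j - g 0 0"
proof -
  have "finite (stairs s f)" "finite (stairs s g)"
    using stairs_bounded[OF f] stairs_bounded[OF g] finite_subset by blast+
  then have "stairs s f = stairs s g"
    using eq unfolding shape_code_def by (metis set_encode_inverse)
  then have "v < f i j - f 0 0 \<longleftrightarrow> v < g i j - g 0 0" for v
    unfolding less_iff_card_stairs[OF f ij] less_iff_card_stairs[OF g ij] by simp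
  from this[of "f i j - f 0 0"] this[of "g i j - g 0 0"] show ?thesis by linarith
qed

section \<open>The structure with a shared table\<close>

lemma realizes_mono: "realizes B pre t e f c \<Longrightarrow> t \<le> t' \<Longrightarrow> realizes B pre t' e f c"
  unfolding realizes_def by (cases c) (simp, blast intro: walk_mono)

lemma realizes_explicit:
  assumes "mono2 (2 ^ e) f" "0 < W" "W \<le> B" "range_of (2 ^ e) f < 2 ^ W"
  shows "\<exists>d. realizes B pre 1 e f (W, 0, e, d) \<and> length d = 6 * W * 4 ^ e"
  using realizes_grid[of e B pre 0 0 f "\<lambda>_ _. (0, 0, 0, [])" W 0 "6 * W * 4 ^ e"] assms
  by (simp add: represents_def fields_le_def bits_of_def)

text \<open>\<open>q = e\<close> and \<open>r = 0\<close> lead all cells of the block to the same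
  record and pass the indices on unchanged. The target is realized with an empty prefix, hence
  wherever its data occur.\<close>

lemma realizes_pointer:
  assumes c: "realizes B [] t e f (W', q', r', d)" and o: "occurs_at pre a d"
    and fit: "a < 2 ^ W" "W' < 2 ^ W" "q' < 2 ^ W" "r' < 2 ^ W" and W: "0 < W" "W \<le> B"
  shows "realizes B pre (Suc t) e f (W, e, 0, rec_bits W 0 0 a q' r' W')"
proof -
  have "walk B bs (Suc t) p W e 0 i j (f i j - f 0 0)"
    if bs: "bs = pre @ ys" "occurs_at bs p (rec_bits W 0 0 a q' r' W')" and ij: "i < 2 ^ e" "j < 2 ^ e"
    for bs ys p i j
  proof -
    have "occurs_at bs a d" using o unfolding bs(1) occurs_at_def by force
    then have "walk B bs t a W' q' r' i j (f i j - f 0 0)"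
      using realizes_walk[OF c _ _ ij] by simp
    then show ?thesis
      using fld_rec_bits[OF bs(2)] fit ij occurs_at_length[OF bs(2)]
      by (intro walk.down[OF W, of p]) (simp_all add: length_rec_bits)
  qed
  then show ?thesis by (auto simp: realizes_def)
qed

lemma shape_table:
  assumes W: "0 < W" "W \<le> B" "x < 2 ^ W"
  shows "\<exists>T. length T = 2 ^ (2 * 2 ^ e * x) * (6 * W * 4 ^ e) \<and>
    (\<forall>f. mono2 (2 ^ e) f \<longrightarrow> range_of (2 ^ e) f \<le> x \<longrightarrow>
       (\<exists>d. occurs_at T (shape_code (2 ^ e) f * (6 * W * 4 ^ e)) d \<and> realizes B [] 1 e f (W, 0, e, d)))"
proof -
  define good where "good k f \<longleftrightarrow> mono2 (2 ^ e) f \<and> range_of (2 ^ e) f \<le> x \<and> shape_code (2 ^ e) f = k" for k f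
  have "\<exists>d. length d = 6 * W * 4 ^ e \<and> (\<forall>f. good k f \<longrightarrow> realizes B [] 1 e f (W, 0, e, d))" for k
  proof (cases "\<exists>f. good k f")
    case True
    then obtain f where f: "good k f" by blast
    then have "range_of (2 ^ e) f < 2 ^ W" using W by (simp add: good_def)
    then obtain d where d: "realizes B [] 1 e f (W, 0, e, d)" "length d = 6 * W * 4 ^ e"
      using realizes_explicit[of e f W B "[]"] f W by (auto simp: good_def)
    have "realizes B [] 1 e g (W, 0, e, d)" if g: "good k g" for g
    proof -
      have "g i j - g 0 0 = f i j - f 0 0" if "i < 2 ^ e" "j < 2 ^ e" for i j
        using f g that by (intro shape_code_inj) (auto simp: good_def)
      then show ?thesis using d(1) by (simp add: realizes_def)
    qed
    with d show ?thesis by blast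
  next
    case False
    \<comment> \<open>Codes of no block get dummy entries, so that entry \<open>k\<close> starts at
      \<open>k\<close> times the entry length.\<close>
    then show ?thesis by (intro exI[of _ "replicate (6 * W * 4 ^ e) False"]) simp
  qed
  then obtain D where D: "\<And>k. length (D k) = 6 * W * 4 ^ e"
    "\<And>k f. good k f \<Longrightarrow> realizes B [] 1 e f (W, 0, e, D k)" by metis
  define T where "T = concat (map D [0..<2 ^ (2 * 2 ^ e * x)])"
  show ?thesis
  proof (rule exI[of _ T], intro conjI allI impI)
    show "length T = 2 ^ (2 * 2 ^ e * x) * (6 * W * 4 ^ e)"
      by (simp add: T_def length_concat_upt D)
    fix f assume f: "mono2 (2 ^ e) f" "range_of (2 ^ e) f \<le> x"
    define k where "k = shape_code (2 ^ e) f"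
    have "k < 2 ^ (2 * 2 ^ e * range_of (2 ^ e) f)" using shape_code_less[OF f(1)] by (simp add: k_def)
    also have "\<dots> \<le> 2 ^ (2 * 2 ^ e * x)" using f(2) by (intro power_increasing) auto
    finally have k: "k < 2 ^ (2 * 2 ^ e * x)" .
    have "occurs_at T 0 (concat (map D [0..<2 ^ (2 * 2 ^ e * x)]))" by (simp add: T_def occurs_at_def)
    from occurs_at_concat[OF this k] have "occurs_at T (k * (6 * W * 4 ^ e)) (D k)" by (simp add: D)
    moreover have "realizes B [] 1 e f (W, 0, e, D k)" using f by (intro D) (simp add: good_def k_def)
    ultimately show "\<exists>d. occurs_at T (shape_code (2 ^ e) f * (6 * W * 4 ^ e)) d \<and> realizes B [] 1 e f (W, 0, e, d)"
      unfolding k_def by blast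
  qed
qed

section \<open>Leaves, the intermediate grid and the root\<close>

lemma represents_const: "mono2 (2 ^ e) f \<Longrightarrow> range_of (2 ^ e) f = 0 \<Longrightarrow> represents B pre t e f (0, 0, 0, [])"
  unfolding represents_def by (auto intro: range_of_0_const)

lemma sq_bit_len_le:
  assumes "0 < d"
  shows "(bit_len d)\<^sup>2 \<le> 3 * d"
proof -
  \<comment> \<open>Equality holds at \<open>b = 3\<close>; from there on a square grows by a factor
    of at most 16/9 per step and the power by 2.\<close>
  have "8 * b\<^sup>2 \<le> 9 * 2 ^ b" for b :: nat
  proof (induction b rule: less_induct)
    case (less b)
    show ?case
    proof (cases "b < 4")
      case True
      then have "b = 0 \<or> b = 1 \<or> b = 2 \<or> b = 3" by linarith
      then show ?thesis by auto
    next
      case False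
      then obtain k where k: "b = Suc k" "3 \<le> k" by (cases b) auto
      have "(Suc k)\<^sup>2 \<le> 2 * k\<^sup>2" using k(2) mult_le_mono1[of 3 k k] unfolding power2_eq_square mult_Suc mult_Suc_right by linarith
      then show ?thesis using less[of k] k by simp
    qed
  qed
  from this[of "bit_len d"] show ?thesis using bit_len_pow[OF assms] by linarith
qed

text \<open>By assumption \<open>2 ^ s\<close> is at most the square root of \<open>8 * d\<close>,
  and \<open>bit_len d\<close> is at most that of \<open>3 * d\<close>; the square root of 24 is
  below 5. Squaring keeps everything in the natural numbers.\<close>

lemma explicit_size:
  assumes "4 ^ s div 8 < d"
  shows "bit_len d * 4 ^ s \<le> 5 * 2 ^ s * d"
proof -
  have d: "0 < d" "4 ^ s \<le> 8 * d" using assms by linarith+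
  have "(2 ^ s * bit_len d)\<^sup>2 = 4 ^ s * (bit_len d)\<^sup>2"
    by (simp add: power_mult_distrib power_mult[symmetric] mult.commute[of s] power_mult)
  also have "\<dots> \<le> (8 * d) * (3 * d)" using d sq_bit_len_le by (intro mult_mono) auto
  also have "\<dots> \<le> (5 * d)\<^sup>2" by (simp add: power2_eq_square)
  finally have "2 ^ s * bit_len d \<le> 5 * d" by (simp only: power2_nat_le_eq_le)
  then have "2 ^ s * (2 ^ s * bit_len d) \<le> 2 ^ s * (5 * d)" by simp
  moreover have "(4::nat) ^ s = 2 ^ s * 2 ^ s" by (simp flip: power_mult_distrib)
  ultimately show ?thesis by (simp add: mult_ac)
qed

text \<open>A table address is about as long as the code, so the pointer of a block takes bits in
  proportion to its own range, not to the largest range in the table. \<open>us\<close> will be the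
  root record that precedes the table.\<close>

lemma represents_leaf:
  assumes T: "\<And>f. mono2 (2 ^ s) f \<Longrightarrow> range_of (2 ^ s) f \<le> 4 ^ s div 8 \<Longrightarrow>
       \<exists>d. occurs_at T (shape_code (2 ^ s) f * (6 * (2 * s + 1) * 4 ^ s)) d \<and>
         realizes B [] 1 s f (2 * s + 1, 0, s, d)"
    and us: "length us \<le> 1536 * 8 ^ s" and f: "mono2 (2 ^ s) f"
    and B: "14 * 8 ^ s \<le> B" "bit_len (range_of (2 ^ s) f) \<le> B"
  shows "\<exists>c. represents B (us @ T) 2 s f c \<and> length (bits_of c) \<le> 84 * 2 ^ s * range_of (2 ^ s) f \<and>
     fields_le (14 * 2 ^ s * range_of (2 ^ s) f) c"
proof -
  define x where "x = range_of (2 ^ s) f"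
  have s: "Suc s \<le> 2 ^ s" using less_exp[of s] by linarith
  consider "x = 0" | "0 < x" "x \<le> 4 ^ s div 8" | "4 ^ s div 8 < x" by linarith
  then show ?thesis
  proof cases
    case 1
    then show ?thesis using represents_const[OF f]
      by (intro exI[of _ "(0, 0, 0, [])"]) (simp add: bits_of_def fields_le_def x_def)
  next
    case 2
    define Z where "Z = 6 * (2 * s + 1) * 4 ^ s"
    define k where "k = shape_code (2 ^ s) f"
    \<comment> \<open>The code length plus room for the factor \<open>2 ^ 11 * 8 ^ s\<close>, which
      bounds the root record and one table entry together.\<close>
    define W where "W = 2 * 2 ^ s * x + 12 * Suc s"
    obtain d where d: "occurs_at T (k * Z) d" "realizes B [] 1 s f (2 * s + 1, 0, s, d)"
      using T[OF f] 2 by (auto simp: x_def k_def Z_def)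
    have o: "occurs_at (us @ T) (length us + k * Z) d"
    proof -
      obtain xs ys where "T = xs @ d @ ys" "length xs = k * Z" using d(1) by (auto simp: occurs_at_def)
      then have "us @ T = (us @ xs) @ d @ ys \<and> length (us @ xs) = length us + k * Z" by simp
      then show ?thesis unfolding occurs_at_def by blast
    qed
    have e8: "(8::nat) ^ s = 2 ^ (3 * s)" by (simp add: power_mult)
    have "Z \<le> 6 * (2 * 2 ^ s) * 4 ^ s" unfolding Z_def using s by (intro mult_mono) auto
    also have "\<dots> = 12 * 8 ^ s" by (simp add: power_mult_distrib[symmetric])
    finally have Z: "Z \<le> 12 * 8 ^ s" .
    have k: "k < 2 ^ (2 * 2 ^ s * x)" using shape_code_less[OF f] by (simp add: k_def x_def)
    have "length us + k * Z \<le> 1536 * 8 ^ s * 2 ^ (2 * 2 ^ s * x) + 2 ^ (2 * 2 ^ s * x) * (12 * 8 ^ s)"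
    proof (intro add_mono mult_mono)
      show "length us \<le> 1536 * 8 ^ s * 2 ^ (2 * 2 ^ s * x)" using us by (rule order.trans) simp
    qed (use Z k in auto)
    also have "\<dots> = 1548 * 8 ^ s * 2 ^ (2 * 2 ^ s * x)" by simp
    also have "\<dots> < 2 ^ 11 * 8 ^ s * 2 ^ (2 * 2 ^ s * x)" by simp
    also have "\<dots> = 2 ^ (11 + 3 * s + 2 * 2 ^ s * x)" by (simp add: e8 power_add)
    also have "\<dots> \<le> 2 ^ W" unfolding W_def by (intro power_increasing) auto
    finally have a: "length us + k * Z < 2 ^ W" .
    have W14: "W \<le> 14 * 2 ^ s * x"
    proof -
      have "12 * Suc s \<le> 12 * 2 ^ s" using s by simp
      also have "\<dots> \<le> 12 * 2 ^ s * x" using 2(1) by simp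
      finally show ?thesis unfolding W_def by (simp add: mult.assoc mult.commute[of x])
    qed
    have WB: "W \<le> B"
    proof -
      have "W \<le> 14 * 2 ^ s * 4 ^ s" using W14 2(2) by (meson div_le_dividend le_trans mult_le_mono2)
      also have "\<dots> = 14 * 8 ^ s" by (simp add: power_mult_distrib[symmetric])
      finally show ?thesis using B by simp
    qed
    have sW: "2 * s + 1 \<le> W" unfolding W_def by simp
    moreover have "W < 2 ^ W" by simp
    ultimately have fit: "2 * s + 1 < 2 ^ W" "0 < (2::nat) ^ W" "s < 2 ^ W" "0 < W" by linarith+
    have "realizes B (us @ T) (Suc 1) s f (W, s, 0, rec_bits W 0 0 (length us + k * Z) 0 s (2 * s + 1))"
      by (rule realizes_pointer[OF d(2) o a fit WB])
    moreover have "s \<le> 14 * 2 ^ s * x" using W14 sW by linarith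
    ultimately show ?thesis using W14
      by (intro exI[of _ "(W, s, 0, rec_bits W 0 0 (length us + k * Z) 0 s (2 * s + 1))"])
        (simp add: represents_def bits_of_def fields_le_def length_rec_bits numeral_2_eq_2 x_def)
  next
    case 3
    have x0: "0 < x" using 3 by linarith
    have w: "0 < bit_len x" "bit_len x \<le> B" using bit_len_pos x0 B by (auto simp: x_def)
    obtain d where d: "realizes B (us @ T) 1 s f (bit_len x, 0, s, d)" "length d = 6 * bit_len x * 4 ^ s"
      using realizes_explicit[OF f w] less_bit_len by (auto simp: x_def)
    have "bit_len x \<le> 14 * 2 ^ s * x" using bit_len_le_self[of x] by (rule order.trans) simp
    moreover have "s \<le> 14 * 2 ^ s * x"
    proof -
      have "s \<le> 2 ^ s * 1" using s by simp
      also have "\<dots> \<le> 14 * 2 ^ s * x" using x0 by (intro mult_mono) auto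
      finally show ?thesis .
    qed
    moreover have "length d \<le> 84 * 2 ^ s * x"
    proof -
      have "6 * (bit_len x * 4 ^ s) \<le> 6 * (5 * 2 ^ s * x)" using explicit_size[OF 3] by (rule mult_le_mono2)
      then show ?thesis unfolding d(2) by (simp add: algebra_simps)
    qed
    ultimately show ?thesis using realizes_mono[OF d(1), of 2]
      by (intro exI[of _ "(bit_len x, 0, s, d)"]) (simp add: represents_def bits_of_def fields_le_def x_def)
  qed
qed

text \<open>Top records of O(log n) bits are affordable for blocks of side \<open>4 ^ s\<close>,
  while the table needs side \<open>2 ^ s\<close>. The summand with \<open>s + 1\<close> is not
  proportional to the range: \<open>4 ^ s\<close> records with fields of more than \<open>s\<close>
  bits may exceed side times range, so they are charged to the number of blocks instead.\<close>

lemma represents_middle: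
  assumes T: "\<And>f. mono2 (2 ^ s) f \<Longrightarrow> range_of (2 ^ s) f \<le> 4 ^ s div 8 \<Longrightarrow>
       \<exists>d. occurs_at T (shape_code (2 ^ s) f * (6 * (2 * s + 1) * 4 ^ s)) d \<and>
         realizes B [] 1 s f (2 * s + 1, 0, s, d)"
    and us: "length us \<le> 1536 * 8 ^ s" and f: "mono2 (2 ^ (2 * s)) f"
    and B: "14 * 8 ^ s \<le> B" "8 * (s + 1 + bit_len (range_of (2 ^ (2 * s)) f)) \<le> B"
  shows "\<exists>c. represents B (us @ T) 3 (2 * s) f c \<and>
     length (bits_of c) \<le> 48 * 4 ^ s * (s + 1) + 216 * 4 ^ s * range_of (2 ^ (2 * s)) f \<and>
     fields_le (8 * (s + 1 + bit_len (range_of (2 ^ (2 * s)) f))) c"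
proof -
  define x where "x = range_of (2 ^ (2 * s)) f"
  show ?thesis
  proof (cases "x = 0")
    case True
    then show ?thesis using represents_const[OF f]
      by (intro exI[of _ "(0, 0, 0, [])"]) (simp add: bits_of_def fields_le_def x_def)
  next
    case False
    define W where "W = 8 * (s + 1 + bit_len x)"
    define u where "u = 14 * 2 ^ s * x"
    have p: "(2::nat) ^ (2 * s) = 2 ^ s * 2 ^ s" by (simp add: mult_2 power_add)
    have p4: "(4::nat) ^ s = 2 ^ s * 2 ^ s" by (simp flip: power_mult_distrib)
    have m: "mono2 (2 ^ s * 2 ^ s) f" using f by (simp add: p)
    define child where "child I J c \<longleftrightarrow> represents B (us @ T) 2 s (block f s I J) c \<and>
        length (bits_of c) \<le> 84 * 2 ^ s * range_of (2 ^ s) (block f s I J) \<and> fields_le u c" for I J c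
    define c where "c I J = (SOME c. child I J c)" for I J
    have "child I J (c I J)" if "I < 2 ^ s" "J < 2 ^ s" for I J
    proof -
      have le: "range_of (2 ^ s) (block f s I J) \<le> x" using range_of_block_le[OF m that] by (simp add: p x_def)
      have "bit_len (range_of (2 ^ s) (block f s I J)) \<le> B" using B(2) bit_len_mono[OF le] by (simp add: x_def)
      from represents_leaf[OF T us mono2_block[OF m that] B(1) this]
      obtain c where c: "represents B (us @ T) 2 s (block f s I J) c"
        "length (bits_of c) \<le> 84 * 2 ^ s * range_of (2 ^ s) (block f s I J)"
        "fields_le (14 * 2 ^ s * range_of (2 ^ s) (block f s I J)) c" by blast
      have "14 * 2 ^ s * range_of (2 ^ s) (block f s I J) \<le> u" using le by (simp add: u_def)
      then have "fields_le u c" using c(3) by (auto simp: fields_le_def split: prod.splits)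
      with c have "child I J c" by (simp add: child_def)
      then show ?thesis unfolding c_def by (rule someI)
    qed
    then have c: "\<And>I J. I < 2 ^ s \<Longrightarrow> J < 2 ^ s \<Longrightarrow> represents B (us @ T) 2 s (block f s I J) (c I J)"
      "\<And>I J. I < 2 ^ s \<Longrightarrow> J < 2 ^ s \<Longrightarrow> length (bits_of (c I J)) \<le> 84 * 2 ^ s * range_of (2 ^ s) (block f s I J)"
      "\<And>I J. I < 2 ^ s \<Longrightarrow> J < 2 ^ s \<Longrightarrow> fields_le u (c I J)"
      by (simp_all add: child_def)
    define L where "L = 6 * W * 4 ^ s + (\<Sum>I<2 ^ s. \<Sum>J<2 ^ s. length (bits_of (c I J)))"
    have "(\<Sum>I<2 ^ s. \<Sum>J<2 ^ s. length (bits_of (c I J))) \<le>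
        (\<Sum>I<2 ^ s. \<Sum>J<2 ^ s. 84 * 2 ^ s * range_of (2 ^ s) (block f s I J))"
      by (intro sum_mono c) auto
    also have "\<dots> = 84 * 2 ^ s * (\<Sum>I<2 ^ s. \<Sum>J<2 ^ s. range_of (2 ^ s) (block f s I J))"
      by (simp only: sum_distrib_left)
    also have "\<dots> \<le> 84 * 2 ^ s * (2 * 2 ^ s * range_of (2 ^ s * 2 ^ s) f)"
      by (intro mult_le_mono2 sum_range_of_block m)
    also have "\<dots> = 168 * 4 ^ s * x" by (simp only: x_def p p4)
    finally have Ls: "L \<le> 6 * W * 4 ^ s + 168 * 4 ^ s * x" unfolding L_def by simp
    have L1: "L \<le> 48 * 4 ^ s * (s + 1) + 216 * 4 ^ s * x"
    proof -
      have "6 * W * 4 ^ s = 48 * 4 ^ s * (s + 1) + 48 * 4 ^ s * bit_len x" by (simp add: W_def algebra_simps)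
      moreover have "48 * 4 ^ s * bit_len x \<le> 48 * 4 ^ s * x" using bit_len_le_self by simp
      ultimately show ?thesis using Ls by linarith
    qed
    have x: "x < 2 ^ bit_len x" by (rule less_bit_len)
    have "L < 2 ^ W"
    proof -
      have "s + 1 \<le> 2 ^ s" using less_exp[of s] by linarith
      then have "48 * 4 ^ s * (s + 1) \<le> 48 * 4 ^ s * 2 ^ s" by (rule mult_le_mono2)
      also have "\<dots> \<le> 48 * 4 ^ s * 2 ^ s * x" using False by simp
      finally have "48 * 4 ^ s * (s + 1) \<le> 48 * 4 ^ s * 2 ^ s * x" .
      moreover have "216 * 4 ^ s * x \<le> 216 * 4 ^ s * 2 ^ s * x" by simp
      ultimately have "L \<le> 48 * 4 ^ s * 2 ^ s * x + 216 * 4 ^ s * 2 ^ s * x" using L1 by linarith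
      also have "\<dots> = 264 * (4 ^ s * 2 ^ s * x)" by (simp add: algebra_simps)
      also have "\<dots> \<le> 2 ^ 9 * (4 ^ s * 2 ^ s * 2 ^ bit_len x)" using x by (intro mult_le_mono) auto
      also have "\<dots> = 2 ^ (9 + 3 * s + bit_len x)"
        using power_mult_distrib[of 4 "2::nat" s] by (simp add: power_add power_mult)
      also have "\<dots> < 2 ^ W" unfolding W_def using bit_len_pos[of x] False
        by (intro power_strict_increasing) auto
      finally show ?thesis .
    qed
    have "\<exists>d. realizes B (us @ T) (Suc 2) (s + s) f (W, s, s, d) \<and> length d = L"
    proof (rule realizes_grid[where c = c and u = u])
      show "mono2 (2 ^ (s + s)) f" using f by (simp add: mult_2)
      show "0 < W" "W \<le> B" using B(2) by (simp_all add: W_def x_def)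
      have "x < 2 ^ bit_len x" by (rule less_bit_len)
      also have "\<dots> \<le> 2 ^ W" by (intro power_increasing) (auto simp: W_def)
      finally show "range_of (2 ^ (s + s)) f < 2 ^ W" by (simp add: x_def mult_2)
      have "u \<le> 2 ^ 4 * 2 ^ s * 2 ^ bit_len x" unfolding u_def using x by (intro mult_le_mono) auto
      also have "\<dots> = 2 ^ (4 + s + bit_len x)" by (simp only: power_add)
      also have "\<dots> < 2 ^ W" unfolding W_def by (intro power_strict_increasing) auto
      finally show "u < 2 ^ W" .
      show "L = 6 * W * 4 ^ s + (\<Sum>I<2 ^ s. \<Sum>J<2 ^ s. length (bits_of (c I J)))" by (rule L_def)
    qed (use c \<open>L < 2 ^ W\<close> in blast)+
    then obtain d where d: "realizes B (us @ T) (Suc 2) (2 * s) f (W, s, s, d)" "length d = L"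
      unfolding mult_2 by blast
    then have "realizes B (us @ T) 3 (2 * s) f (W, s, s, d)" by (simp add: eval_nat_numeral)
    then show ?thesis using L1 d(2)
      by (intro exI[of _ "(W, s, s, d)"])
        (simp add: represents_def bits_of_def fields_le_def W_def flip: x_def)
  qed
qed

text \<open>The root record supplies \<open>F 0 0\<close>, since the values in a node are relative
  to the first entry of its block. The table follows directly, so its address is known before any
  node is built. \<open>q\<close> stays free because the query enters with the word size.\<close>

lemma assemble:
  assumes F: "mono2 (2 ^ k) F" and e: "e \<le> k"
    and pre: "pre = rec_bits B (F 0 0) 0 (6 * B + length T) e (k - e) B @ T"
    and c: "\<And>I J. I < 2 ^ (k - e) \<Longrightarrow> J < 2 ^ (k - e) \<Longrightarrow>
      \<exists>c. represents B pre t e (block F e I J) c \<and> length (bits_of c) \<le> X I J \<and> fields_le B c"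
    and B: "0 < B" "k < 2 ^ B" "F (2 ^ k - 1) (2 ^ k - 1) < 2 ^ B"
      "6 * B + length T + (6 * B * 4 ^ (k - e) + (\<Sum>I<2 ^ (k - e). \<Sum>J<2 ^ (k - e). X I J)) < 2 ^ B"
  shows "\<exists>bs. length bs \<le> 6 * B + length T + (6 * B * 4 ^ (k - e) + (\<Sum>I<2 ^ (k - e). \<Sum>J<2 ^ (k - e). X I J)) \<and>
    (\<forall>i<2 ^ k. \<forall>j<2 ^ k. \<forall>q\<ge>k. walk B bs (t + 2) 0 B q 0 i j (F i j))"
proof -
  define r where "r = k - e"
  have k: "e + r = k" using e by (simp add: r_def)
  define child where "child I J c \<longleftrightarrow> represents B pre t e (block F e I J) c \<and> length (bits_of c) \<le> X I J \<and> fields_le B c"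
    for I J c
  define c where "c I J = (SOME c. child I J c)" for I J
  have "child I J (c I J)" if "I < 2 ^ r" "J < 2 ^ r" for I J
  proof -
    have "\<exists>c. child I J c" using c[of I J] that unfolding r_def child_def by blast
    then show ?thesis unfolding c_def by (rule someI_ex)
  qed
  then have c: "\<And>I J. I < 2 ^ r \<Longrightarrow> J < 2 ^ r \<Longrightarrow> represents B pre t e (block F e I J) (c I J)"
      "\<And>I J. I < 2 ^ r \<Longrightarrow> J < 2 ^ r \<Longrightarrow> length (bits_of (c I J)) \<le> X I J"
      "\<And>I J. I < 2 ^ r \<Longrightarrow> J < 2 ^ r \<Longrightarrow> fields_le B (c I J)"
    by (simp_all add: child_def)
  define L where "L = 6 * B * 4 ^ r + (\<Sum>I<2 ^ r. \<Sum>J<2 ^ r. length (bits_of (c I J)))"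
  have L: "L \<le> 6 * B * 4 ^ r + (\<Sum>I<2 ^ r. \<Sum>J<2 ^ r. X I J)"
    unfolding L_def by (intro add_left_mono sum_mono c) auto
  have BB: "B < 2 ^ B" by simp
  have LB: "L < 2 ^ B" using L B(4) unfolding r_def by linarith
  have "\<exists>d. realizes B pre (Suc t) (e + r) F (B, e, r, d) \<and> length d = L"
  proof (rule realizes_grid[where c = c and u = B])
    show "mono2 (2 ^ (e + r)) F" using F k by simp
    have "range_of (2 ^ k) F \<le> F (2 ^ k - 1) (2 ^ k - 1)" unfolding range_of_def by simp
    then show "range_of (2 ^ (e + r)) F < 2 ^ B" using B(3) unfolding k by linarith
    show "L = 6 * B * 4 ^ r + (\<Sum>I<2 ^ r. \<Sum>J<2 ^ r. length (bits_of (c I J)))" by (rule L_def)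
  qed (use c LB B BB in blast)+
  then obtain d where d: "realizes B pre (Suc t) k F (B, e, r, d)" "length d = L" unfolding k by blast
  define bs where "bs = pre @ d"
  have lp: "length pre = 6 * B + length T" by (simp add: pre length_rec_bits)
  have "walk B bs (t + 2) 0 B q 0 i j (F i j)" if ij: "i < 2 ^ k" "j < 2 ^ k" and q: "k \<le> q" for i j q
  proof -
    have "occurs_at bs (length pre) d" unfolding bs_def occurs_at_def
      by (rule exI[of _ pre], rule exI[of _ "[]"]) simp
    from realizes_walk[OF d(1) bs_def this ij]
    have w: "walk B bs (Suc t) (6 * B + length T) B e r i j (F i j - F 0 0)" unfolding lp .
    have o: "occurs_at bs 0 (rec_bits B (F 0 0) 0 (6 * B + length T) e r B)"
      unfolding bs_def pre occurs_at_def r_def by (rule exI[of _ "[]"], rule exI[of _ "T @ d"]) simp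
    have p: "2 ^ k - 1 < (2::nat) ^ k" by simp
    have "F 0 0 \<le> F (2 ^ k - 1) (2 ^ k - 1)" by (intro mono2D[OF F]) (use p in auto)
    then have f: "F 0 0 < 2 ^ B" "6 * B + length T < 2 ^ B" "e < 2 ^ B" "r < 2 ^ B" "B < 2 ^ B" "0 < (2::nat) ^ B"
      using B k by linarith+
    note fl = fld_rec_bits(1)[OF o f(1)] fld_rec_bits(2)[OF o f(6)] fld_rec_bits(3)[OF o f(2)]
      fld_rec_bits(4)[OF o f(3)] fld_rec_bits(5)[OF o f(4)] fld_rec_bits(6)[OF o f(5)]
    have iq: "i < 2 ^ q" "j < 2 ^ q"
      using ij power_increasing[OF q, of "2::nat"] by linarith+
    have "F 0 0 \<le> F i j" by (intro mono2D[OF F]) (use ij in auto)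
    then have fe: "F i j = F 0 0 + (F i j - F 0 0)" by simp
    have "walk B bs (Suc (Suc t)) 0 B q 0 i j (F i j)"
    proof (rule walk.down[where a = 0 and y' = "F i j - F 0 0"])
      show "0 + 6 * B \<le> length bs" using occurs_at_length[OF o] by (simp add: length_rec_bits)
      show "walk B bs (Suc t) (fld bs (0 + B) B * 0 + fld bs (0 + 2 * B) B) (fld bs (0 + 5 * B) B)
            (fld bs (0 + 3 * B) B) (fld bs (0 + 4 * B) B) (i mod 2 ^ q) (j mod 2 ^ q) (F i j - F 0 0)"
        using w iq fl by simp
      show "0 = 0 + 6 * B * (i div 2 ^ q * 2 ^ 0 + j div 2 ^ q)" using iq by simp
      show "F i j = fld bs 0 B + (F i j - F 0 0)" using fe fl(1) by simp
    qed (use B in simp_all)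
    then show ?thesis by simp
  qed
  moreover have "length bs = 6 * B + length T + L" by (simp add: bs_def lp d)
  ultimately show ?thesis using L unfolding r_def by (intro exI[of _ bs]) simp
qed

section \<open>Space and time bounds\<close>

lemma fields_le_mono: "fields_le u c \<Longrightarrow> u \<le> u' \<Longrightarrow> fields_le u' c"
  by (auto simp: fields_le_def split: prod.splits)

lemma twice_le_exp: "2 * r \<le> 2 ^ r" for r :: nat
proof (cases r)
  case (Suc r')
  have "2 * Suc r' \<le> 2 * 2 ^ r'" by (intro mult_le_mono2 Suc_leI) simp
  then show ?thesis unfolding Suc power_Suc .
qed simp

lemma deep_structure:
  assumes m: "0 < m" "m < n" and F: "mono2 (2 ^ k) F" "F (2 ^ k - 1) (2 ^ k - 1) < m"
    and n: "n \<le> 2 ^ k" "2 ^ k < 2 * n" and s: "2 ^ s * m < n" "k < 8 ^ Suc s"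
  shows "\<exists>bs e \<beta>. length bs \<le> 7500 * (Suc (depth e) * (n * m)) \<and> length bs < 2 ^ (32 * k) \<and>
    e \<le> 2 * \<beta> \<and> 2 ^ \<beta> * m < 2 * n \<and>
    (\<forall>i<2 ^ k. \<forall>j<2 ^ k. \<forall>q\<ge>k. walk (32 * k) bs (depth e + 2) 0 (32 * k) q 0 i j (F i j))"
proof -
  \<comment> \<open>Width of the root and top records: it covers \<open>8 * (k + k)\<close>, the
    largest parameter of a child, and the exponent in the bound
    \<open>2 ^ (13 + (k + (k + k)))\<close> on the total length.\<close>
  define B where "B = 32 * k"
  have k: "0 < k" using n m by (cases k) auto
  have kn: "k < n" using twice_le_exp[of k] n by linarith
  have nm: "n \<le> n * m" using m by simp
  define \<beta> where "\<beta> = (LEAST b. n \<le> 2 ^ b * m)"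
  have "n \<le> 2 ^ k * m" using mult_le_mono[of n "2 ^ k" 1 m] n m by simp
  then have b1: "n \<le> 2 ^ \<beta> * m" unfolding \<beta>_def by (rule LeastI)
  have sb: "s < \<beta>"
  proof (rule ccontr)
    assume "\<not> s < \<beta>"
    then have "(2::nat) ^ \<beta> \<le> 2 ^ s" by (intro power_increasing) auto
    then have "2 ^ \<beta> * m \<le> 2 ^ s * m" by (rule mult_le_mono1)
    then show False using b1 s(1) by linarith
  qed
  have b2: "2 ^ \<beta> * m < 2 * n"
  proof -
    obtain b where b: "\<beta> = Suc b" using sb by (cases \<beta>) auto
    then have "\<not> n \<le> 2 ^ b * m" unfolding \<beta>_def using not_less_Least by (metis \<beta>_def lessI)
    then show ?thesis using b by simp
  qed
  \<comment> \<open>The block side is about the square of \<open>n / m\<close>, unless this exceeds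
    the side of the matrix.\<close>
  define e where "e = min k (2 * \<beta>)"
  have e: "e \<le> k" "e \<le> 2 * \<beta>" by (simp_all add: e_def)
  have p: "2 ^ (k - e) * 2 ^ e = (2::nat) ^ k" using e(1) by (simp flip: power_add)
  have m2: "mono2 (2 ^ (k - e) * 2 ^ e) F" using F(1) by (simp add: p)
  have rF: "range_of (2 ^ k) F \<le> m" using F(2) by (simp add: range_of_def)
  have m2k: "m < 2 ^ k" using m n by linarith
  define X where "X I J = tree_size e (block F e I J)" for I J
  define pre where "pre = rec_bits B (F 0 0) 0 (6 * B + length ([]::bool list)) e (k - e) B @ []"
  have children: "\<exists>c. represents B pre (depth e) e (block F e I J) c \<and> length (bits_of c) \<le> X I J \<and> fields_le B c"
    if "I < 2 ^ (k - e)" "J < 2 ^ (k - e)" for I J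
  proof -
    have "range_of (2 ^ e) (block F e I J) < 2 ^ k" using range_of_block_le[OF m2 that] rF m2k by (simp add: p)
    then have "bit_len (range_of (2 ^ e) (block F e I J)) \<le> k" by (rule bit_len_le)
    then have "8 * (e + bit_len (range_of (2 ^ e) (block F e I J))) \<le> 8 * (k + k)"
      using e(1) by (intro mult_le_mono2 add_mono)
    then have le: "8 * (e + bit_len (range_of (2 ^ e) (block F e I J))) \<le> B" by (simp add: B_def)
    from represents_tree[OF mono2_block[OF m2 that] le] fields_le_mono[OF _ le] show ?thesis
      unfolding X_def by blast
  qed
  have top: "k * 4 ^ (k - e) \<le> 4 * (n * m)"
  proof (cases "k \<le> 2 * \<beta>")
    case True
    have "k \<le> 4 * (n * m)" using kn nm by linarith
    then show ?thesis using True by (simp add: e_def)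
  next
    case False
    then have ee: "e = 2 * \<beta>" by (simp add: e_def)
    have p4: "(4::nat) ^ k = 2 ^ k * 2 ^ k" by (simp flip: power_mult_distrib)
    have p8: "(8::nat) ^ \<beta> * 2 ^ \<beta> = 4 ^ (2 * \<beta>)" by (simp add: power_mult flip: power_mult_distrib)
    \<comment> \<open>Here the threshold enters: \<open>k <= 8 ^ \<beta>\<close> and
      \<open>n <= 2 ^ \<beta> * m\<close> bound \<open>k * n\<close> by
      \<open>16 ^ \<beta> * m\<close>, and \<open>16 ^ \<beta>\<close> is the square of the block
      side.\<close>
    have "k \<le> 8 ^ \<beta>" using s(2) sb power_increasing[of "Suc s" \<beta> "8::nat"] by simp
    then have "k * (2 ^ k * 2 ^ k) \<le> 8 ^ \<beta> * ((2 * n) * (2 * n))" using n by (intro mult_le_mono) auto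
    also have "\<dots> \<le> 8 ^ \<beta> * ((2 * n) * (2 * (2 ^ \<beta> * m)))" using b1 by (intro mult_le_mono) auto
    also have "\<dots> = (8 ^ \<beta> * 2 ^ \<beta>) * (4 * (n * m))" by (simp add: mult_ac)
    finally have le: "k * 4 ^ k \<le> 4 ^ e * (4 * (n * m))" unfolding p8 p4 ee .
    have "4 ^ k = (4::nat) ^ e * 4 ^ (k - e)" using e(1) by (simp flip: power_add)
    then have "4 ^ e * (k * 4 ^ (k - e)) \<le> 4 ^ e * (4 * (n * m))" using le by (simp add: mult_ac)
    then show ?thesis by simp
  qed
  have sumX: "(\<Sum>I<2 ^ (k - e). \<Sum>J<2 ^ (k - e). X I J) \<le> 6144 * (depth e * (n * m))"
  proof -
    have "(\<Sum>I<2 ^ (k - e). \<Sum>J<2 ^ (k - e). X I J) \<le>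
        1536 * depth e * 2 ^ e * (2 * 2 ^ (k - e) * range_of (2 ^ (k - e) * 2 ^ e) F)"
      unfolding X_def by (rule sum_tree_size[OF m2])
    also have "\<dots> = 3072 * (depth e * ((2 ^ (k - e) * 2 ^ e) * range_of (2 ^ k) F))" unfolding p by (simp add: p[symmetric])
    also have "\<dots> \<le> 3072 * (depth e * ((2 * n) * m))" using n rF unfolding p by (intro mult_le_mono) auto
    finally show ?thesis by (simp add: mult_ac)
  qed
  define Y where "Y = 6 * B + length ([]::bool list) + (6 * B * 4 ^ (k - e) + (\<Sum>I<2 ^ (k - e). \<Sum>J<2 ^ (k - e). X I J))"
  have Y: "Y \<le> 7500 * (Suc (depth e) * (n * m))"
  proof -
    have "6 * B * 4 ^ (k - e) \<le> 768 * (n * m)"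
      using mult_le_mono2[OF top, of 192] unfolding B_def by (simp add: mult_ac)
    moreover have "6 * B \<le> 192 * (n * m)" using kn nm unfolding B_def by linarith
    ultimately have "Y \<le> 960 * (n * m) + 6144 * (depth e * (n * m))" using sumX unfolding Y_def list.size by linarith
    then show ?thesis by simp
  qed
  have YB: "Y < 2 ^ B"
  proof -
    have "Suc (depth e) \<le> 2 ^ k" using depth_le[of e] e(1) less_exp[of k] by linarith
    then have "7500 * (Suc (depth e) * (n * m)) \<le> 2 ^ 13 * (2 ^ k * (2 ^ k * 2 ^ k))"
      using n m2k by (intro mult_le_mono) auto
    also have "\<dots> = 2 ^ (13 + (k + (k + k)))" by (simp only: power_add)
    also have "\<dots> < 2 ^ B" unfolding B_def using k by (intro power_strict_increasing) auto
    finally show ?thesis using Y by simp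
  qed
  have "\<exists>bs. length bs \<le> Y \<and> (\<forall>i<2 ^ k. \<forall>j<2 ^ k. \<forall>q\<ge>k. walk B bs (depth e + 2) 0 B q 0 i j (F i j))"
    unfolding Y_def
  proof (rule assemble[OF F(1) e(1) pre_def children])
    show "0 < B" using k by (simp add: B_def)
    have "k < 2 ^ k" "(2::nat) ^ k \<le> 2 ^ B" by (simp_all add: B_def)
    then show "k < 2 ^ B" "F (2 ^ k - 1) (2 ^ k - 1) < 2 ^ B" using F(2) m2k by linarith+
    show "6 * B + length ([]::bool list) +
        (6 * B * 4 ^ (k - e) + (\<Sum>I<2 ^ (k - e). \<Sum>J<2 ^ (k - e). X I J)) < 2 ^ B"
      using YB unfolding Y_def .
  qed
  then obtain bs where bs: "length bs \<le> Y" "\<forall>i<2 ^ k. \<forall>j<2 ^ k. \<forall>q\<ge>k. walk B bs (depth e + 2) 0 B q 0 i j (F i j)"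
    by blast
  then have "length bs \<le> 7500 * (Suc (depth e) * (n * m))" "length bs < 2 ^ B" using Y YB by linarith+
  then show ?thesis using bs(2) e(2) b2 unfolding B_def by blast
qed

text \<open>Here \<open>2 ^ s\<close> is the cube root of \<open>k\<close> up to a factor of 2. This
  one choice has to keep the table small and to make the top grid with blocks of side
  \<open>4 ^ s\<close> affordable.\<close>

lemma shallow_structure:
  assumes m: "0 < m" "m < n" and F: "mono2 (2 ^ k) F" "F (2 ^ k - 1) (2 ^ k - 1) < m"
    and n: "n \<le> 2 ^ k" "2 ^ k < 2 * n" and s: "n \<le> 2 ^ s * m" "8 ^ s \<le> k" "k < 8 ^ Suc s"
  shows "\<exists>bs. length bs \<le> 7500 * (n * m) \<and> length bs < 2 ^ (32 * k) \<and>
    (\<forall>i<2 ^ k. \<forall>j<2 ^ k. \<forall>q\<ge>k. walk (32 * k) bs 5 0 (32 * k) q 0 i j (F i j))"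
proof -
  define B where "B = 32 * k"
  have k: "0 < k" using n m by (cases k) auto
  have s2: "Suc s \<le> 2 ^ s" using less_exp[of s] by linarith
  have p4: "(4::nat) ^ a = 2 ^ a * 2 ^ a" for a by (simp flip: power_mult_distrib)
  have p8: "(8::nat) ^ s = 4 ^ s * 2 ^ s" by (simp flip: power_mult_distrib)
  have "2 ^ s * 1 \<le> 2 ^ s * (4::nat) ^ s" by (intro mult_le_mono) auto
  then have "2 ^ s \<le> (8::nat) ^ s" by (simp add: p8 mult.commute)
  then have sk: "2 ^ s \<le> k" "Suc s \<le> k" using s(2) s2 by linarith+
  have e: "2 * s \<le> k" using twice_le_exp[of s] sk by linarith
  have p: "2 ^ (k - 2 * s) * 2 ^ (2 * s) = (2::nat) ^ k" using e by (simp flip: power_add)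
  have m2: "mono2 (2 ^ (k - 2 * s) * 2 ^ (2 * s)) F" using F(1) by (simp add: p)
  have rF: "range_of (2 ^ k) F \<le> m" using F(2) by (simp add: range_of_def)
  have m2k: "m < 2 ^ k" using m n by linarith
  have nm: "n \<le> n * m" using m by simp
  \<comment> \<open>The largest tabulated range: the codes have at most
    \<open>2 * 2 ^ s * x <= 8 ^ s / 4 <= k / 4\<close> bits, which limits the number of table
    entries.\<close>
  define x :: nat where "x = 4 ^ s div 8"
  have "x \<le> 4 ^ s" by (simp add: x_def)
  moreover have "(4::nat) ^ s < 2 ^ (2 * s + 1)" by (simp add: power_mult)
  ultimately have xW: "x < 2 ^ (2 * s + 1)" by linarith
  have W: "0 < 2 * s + 1" "2 * s + 1 \<le> B" using sk unfolding B_def by linarith+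
  obtain T where T: "length T = 2 ^ (2 * 2 ^ s * x) * (6 * (2 * s + 1) * 4 ^ s)"
    "\<And>f. mono2 (2 ^ s) f \<Longrightarrow> range_of (2 ^ s) f \<le> x \<Longrightarrow>
       \<exists>d. occurs_at T (shape_code (2 ^ s) f * (6 * (2 * s + 1) * 4 ^ s)) d \<and>
         realizes B [] 1 s f (2 * s + 1, 0, s, d)"
    using shape_table[OF W xW, of s] by blast
  define us where "us = rec_bits B (F 0 0) 0 (6 * B + length T) (2 * s) (k - 2 * s) B"
  have us: "length us \<le> 1536 * 8 ^ s" using s(3) by (simp add: us_def length_rec_bits B_def)
  define X where "X I J = 48 * 4 ^ s * (s + 1) + 216 * 4 ^ s * range_of (2 ^ (2 * s)) (block F (2 * s) I J)" for I J
  have children: "\<exists>c. represents B (us @ T) 3 (2 * s) (block F (2 * s) I J) c \<and> length (bits_of c) \<le> X I J \<and> fields_le B c"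
    if "I < 2 ^ (k - 2 * s)" "J < 2 ^ (k - 2 * s)" for I J
  proof -
    have "range_of (2 ^ (2 * s)) (block F (2 * s) I J) < 2 ^ k" using range_of_block_le[OF m2 that] rF m2k by (simp add: p)
    then have "bit_len (range_of (2 ^ (2 * s)) (block F (2 * s) I J)) \<le> k" by (rule bit_len_le)
    then have "8 * (s + 1 + bit_len (range_of (2 ^ (2 * s)) (block F (2 * s) I J))) \<le> 8 * (k + k)"
      using sk by (intro mult_le_mono2 add_mono) simp_all
    then have le: "8 * (s + 1 + bit_len (range_of (2 ^ (2 * s)) (block F (2 * s) I J))) \<le> B" by (simp add: B_def)
    have "14 * 8 ^ s \<le> B" using s(2) unfolding B_def by linarith
    from represents_middle[OF T(2)[unfolded x_def] us mono2_block[OF m2 that] this le] fields_le_mono[OF _ le]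
    show ?thesis unfolding X_def by blast
  qed
  have top: "k * 4 ^ (k - 2 * s) \<le> 32 * (n * m)"
  proof -
    have "k * (2 ^ k * 2 ^ k) \<le> (8 * 8 ^ s) * ((2 * n) * (2 * n))" using n s(3) by (intro mult_le_mono) auto
    also have "\<dots> \<le> (8 * 8 ^ s) * ((2 * n) * (2 * (2 ^ s * m)))" using s(1) by (intro mult_le_mono) auto
    also have "\<dots> = (8 ^ s * 2 ^ s) * (32 * (n * m))" by (simp add: mult_ac)
    also have "(8::nat) ^ s * 2 ^ s = 4 ^ (2 * s)" by (simp add: power_mult flip: power_mult_distrib)
    finally have le: "k * 4 ^ k \<le> 4 ^ (2 * s) * (32 * (n * m))" unfolding p4[of k] .
    have "4 ^ k = (4::nat) ^ (2 * s) * 4 ^ (k - 2 * s)" using e by (simp flip: power_add)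
    then have "4 ^ (2 * s) * (k * 4 ^ (k - 2 * s)) \<le> 4 ^ (2 * s) * (32 * (n * m))" using le by (simp add: mult_ac)
    then show ?thesis by simp
  qed
  \<comment> \<open>The part of the intermediate records that is independent of the range:
    \<open>Suc s <= 2 ^ s\<close> and \<open>n <= 2 ^ s * m\<close> each use up one factor
    \<open>2 ^ s\<close> of the \<open>4 ^ s\<close> gained from the grid.\<close>
  have mid: "Suc s * (4 ^ (k - 2 * s) * 4 ^ s) \<le> 4 * (n * m)"
  proof -
    have "Suc s * (2 ^ k * 2 ^ k) \<le> 2 ^ s * ((2 * n) * (2 * n))" using n s2 by (intro mult_le_mono) auto
    also have "\<dots> \<le> 2 ^ s * ((2 * n) * (2 * (2 ^ s * m)))" using s(1) by (intro mult_le_mono) auto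
    also have "\<dots> = 4 ^ s * (4 * (n * m))" unfolding p4[of s] by (simp add: mult_ac)
    finally have le: "Suc s * 4 ^ k \<le> 4 ^ s * (4 * (n * m))" unfolding p4[of k] .
    have "4 ^ k = (4::nat) ^ s * (4 ^ (k - 2 * s) * 4 ^ s)" using e by (simp flip: power_add)
    then have "4 ^ s * (Suc s * (4 ^ (k - 2 * s) * 4 ^ s)) \<le> 4 ^ s * (4 * (n * m))" using le by (simp only: mult_ac)
    then show ?thesis by simp
  qed
  have sumX: "(\<Sum>I<2 ^ (k - 2 * s). \<Sum>J<2 ^ (k - 2 * s). X I J) \<le> 1056 * (n * m)"
  proof -
    have "(\<Sum>I<2 ^ (k - 2 * s). \<Sum>J<2 ^ (k - 2 * s). X I J) =
      48 * (Suc s * (4 ^ (k - 2 * s) * 4 ^ s)) +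
      216 * 4 ^ s * (\<Sum>I<2 ^ (k - 2 * s). \<Sum>J<2 ^ (k - 2 * s). range_of (2 ^ (2 * s)) (block F (2 * s) I J))"
    proof -
      have "(\<Sum>I<N. \<Sum>J<N. 48 * 4 ^ s * (s + 1)) = 48 * (Suc s * ((N * N) * 4 ^ s))" for N
        by (simp add: algebra_simps)
      then show ?thesis unfolding X_def sum.distrib sum_distrib_left p4[of "k - 2 * s"] by simp
    qed
    also have "\<dots> \<le> 48 * (4 * (n * m)) + 216 * 4 ^ s * (2 * 2 ^ (k - 2 * s) * range_of (2 ^ (k - 2 * s) * 2 ^ (2 * s)) F)"
      by (intro add_mono mult_le_mono2 mid sum_range_of_block m2)
    also have "216 * 4 ^ s * (2 * 2 ^ (k - 2 * s) * range_of (2 ^ (k - 2 * s) * 2 ^ (2 * s)) F) =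
        432 * (2 ^ k * range_of (2 ^ k) F)" unfolding p by (simp add: p[symmetric] power_mult)
    also have "\<dots> \<le> 432 * ((2 * n) * m)" using n rF by (intro mult_le_mono) auto
    finally show ?thesis by (simp add: mult.commute[of m])
  qed
  have lenT: "length T \<le> 24 * (n * m)"
  proof -
    define q where "q = 2 * 2 ^ s * x"
    have "8 * x \<le> 4 ^ s" unfolding x_def by simp
    then have "2 ^ s * (8 * x) \<le> 2 ^ s * 4 ^ s" by (rule mult_le_mono2)
    also have "\<dots> = 8 ^ s" by (simp add: p8)
    finally have "2 ^ s * (8 * x) \<le> k" using s(2) by linarith
    moreover have "4 * q = 2 ^ s * (8 * x)" by (simp add: q_def)
    ultimately have q: "4 * q \<le> k" by (simp only:)
    have "(2 * s + 1) \<le> 2 * 2 ^ s" using s2 by linarith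
    then have "6 * (2 * s + 1) * 4 ^ s \<le> 6 * (2 * 2 ^ s) * 4 ^ s" by (intro mult_le_mono) auto
    also have "\<dots> \<le> 12 * k" using s(2) by (simp add: p8 mult_ac)
    finally have "length T \<le> 2 ^ q * (12 * k)" unfolding T(1) q_def by (rule mult_le_mono2)
    also have "k \<le> 2 * (k - q)" using q by linarith
    also have "\<dots> \<le> 2 ^ (k - q)" by (rule twice_le_exp)
    finally have "length T \<le> 2 ^ q * (12 * 2 ^ (k - q))" by simp
    also have "\<dots> = 12 * 2 ^ (q + (k - q))" by (simp add: power_add)
    also have "q + (k - q) = k" using q by linarith
    finally show ?thesis using n nm by linarith
  qed
  define Y where "Y = 6 * B + length T + (6 * B * 4 ^ (k - 2 * s) + (\<Sum>I<2 ^ (k - 2 * s). \<Sum>J<2 ^ (k - 2 * s). X I J))"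
  have kn: "k \<le> n"
    using twice_le_exp[of k] n by linarith
  \<comment> \<open>6144 + 192 + 1056 + 24 = 7416, from the top grid, the root record, the children
    and the table.\<close>
  have Y: "Y \<le> 7500 * (n * m)"
  proof -
    have "6 * B * 4 ^ (k - 2 * s) \<le> 6144 * (n * m)"
      using mult_le_mono2[OF top, of 192] unfolding B_def by (simp add: mult_ac)
    moreover have "6 * B \<le> 192 * (n * m)" using kn nm unfolding B_def by linarith
    ultimately show ?thesis using sumX lenT unfolding Y_def by linarith
  qed
  have YB: "Y < 2 ^ B"
  proof -
    have "7500 * (n * m) \<le> 2 ^ 13 * (2 ^ k * 2 ^ k)" using n m2k by (intro mult_le_mono) auto
    also have "\<dots> = 2 ^ (13 + (k + k))" by (simp only: power_add)
    also have "\<dots> < 2 ^ B" unfolding B_def using k by (intro power_strict_increasing) auto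
    finally show ?thesis using Y by simp
  qed
  have "\<exists>bs. length bs \<le> Y \<and> (\<forall>i<2 ^ k. \<forall>j<2 ^ k. \<forall>q\<ge>k. walk B bs (3 + 2) 0 B q 0 i j (F i j))"
    unfolding Y_def
  proof (rule assemble[OF F(1) e _ children])
    show "us @ T = rec_bits B (F 0 0) 0 (6 * B + length T) (2 * s) (k - 2 * s) B @ T" by (simp add: us_def)
    show "0 < B" using k by (simp add: B_def)
    have "k < 2 ^ k" "(2::nat) ^ k \<le> 2 ^ B" by (simp_all add: B_def)
    then show "k < 2 ^ B" "F (2 ^ k - 1) (2 ^ k - 1) < 2 ^ B" using F(2) m2k by linarith+
    show "6 * B + length T +
        (6 * B * 4 ^ (k - 2 * s) + (\<Sum>I<2 ^ (k - 2 * s). \<Sum>J<2 ^ (k - 2 * s). X I J)) < 2 ^ B"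
      using YB unfolding Y_def .
  qed
  then obtain bs where bs: "length bs \<le> Y" "\<forall>i<2 ^ k. \<forall>j<2 ^ k. \<forall>q\<ge>k. walk B bs 5 0 B q 0 i j (F i j)"
    by auto
  then have "length bs \<le> 7500 * (n * m)" "length bs < 2 ^ B" using Y YB by linarith+
  then show ?thesis using bs(2) unfolding B_def by blast
qed

text \<open>The cube is the first power that works: a level multiplies \<open>e ^ 3\<close> by at
  most 27/64, which is below 1/2, whereas 9/16 for the square is not.\<close>

lemma depth_exp: "0 < e \<Longrightarrow> 2 ^ depth e \<le> 2 * e ^ 3"
proof (induction e rule: less_induct)
  case (less e)
  define e' where "e' = 3 * e div 4"
  have d: "depth e = Suc (depth e')" using less.prems by (subst depth.simps) (simp add: e'_def)
  show ?case
  proof (cases "e' = 0")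
    case True
    then have "depth e = 1" using d by (simp add: depth.simps)
    then show ?thesis using less.prems by simp
  next
    case False
    then have IH: "2 ^ depth e' \<le> 2 * e' ^ 3" using less.prems by (intro less.IH) (auto simp: e'_def)
    have "4 * e' \<le> 3 * e" by (simp add: e'_def)
    then have "(4 * e') ^ 3 \<le> (3 * e) ^ 3" by (rule power_mono) simp
    then have "64 * e' ^ 3 \<le> 27 * e ^ 3" by (simp add: power_mult_distrib)
    then show ?thesis using IH unfolding d by simp
  qed
qed

text \<open>For \<open>L = loglog (n / m)\<close>, \<open>e\<close> is at most
  \<open>2 powr (L + 2)\<close>, and \<open>depth_exp\<close> turns this into a depth of at most
  \<open>7 + 3 * L\<close>; \<open>L >= 1\<close> absorbs the 7.\<close>

lemma depth_le_loglog:
  assumes m: "0 < m" "m < n" and e: "e \<le> 2 * b" "2 ^ b * m < 2 * n"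
  shows "real (depth e) \<le> 10 * loglog (real n / real m)"
proof (cases "e = 0")
  case False
  define L where "L = loglog (real n / real m)"
  have L: "1 \<le> L" "log 2 (log 2 (real n / real m)) \<le> L" by (simp_all add: L_def loglog_def)
  have q: "1 < real n / real m" using m by simp
  then have l0: "0 < log 2 (real n / real m)" by simp
  have l: "log 2 (real n / real m) \<le> 2 powr L" using L(2) l0 by (simp add: log_le_iff)
  have "real (2 ^ b * m) < real (2 * n)" using e(2) by (simp only: of_nat_less_iff)
  then have "2 ^ b < 2 * (real n / real m)" using m by (simp add: field_simps)
  then have "log 2 (2 ^ b) < log 2 (2 * (real n / real m))" using q by (intro log_less) auto
  moreover have "log 2 (2 * (real n / real m)) = 1 + log 2 (real n / real m)"
    using q by (subst log_mult) auto
  ultimately have "real b < 1 + log 2 (real n / real m)" by simp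
  then have "real b \<le> 1 + 2 powr L" using l by linarith
  also have "\<dots> \<le> 2 powr L + 2 powr L" using L(1) by (simp add: ge_one_powr_ge_zero)
  finally have "real e \<le> 4 * 2 powr L" using e(1) by linarith
  also have "\<dots> = 2 powr (L + 2)" by (simp add: powr_add)
  finally have re: "real e \<le> 2 powr (L + 2)" .
  have "2 powr real (depth e) = real (2 ^ depth e)" by (simp add: powr_realpow)
  also have "\<dots> \<le> real (2 * e ^ 3)" using depth_exp[of e] False by (simp only: of_nat_le_iff)
  also have "\<dots> \<le> 2 * (2 powr (L + 2)) ^ 3" using re by (simp add: power_mono)
  also have "\<dots> = 2 powr (1 + 3 * (L + 2))" by (simp add: powr_add powr_power mult.commute)
  finally have "real (depth e) \<le> 7 + 3 * L" by simp
  then have "real (depth e) \<le> 10 * L" using L(1) by linarith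
  then show ?thesis unfolding L_def .
qed (simp add: depth.simps loglog_def)

section \<open>Extending the matrix and choosing between the two structures\<close>

lemma IMS2_mono:
  assumes A: "A \<in> IMS2 n m" and ij: "i \<le> i'" "i' < n" "j \<le> j'" "j' < n"
  shows "A i j \<le> A i' j'"
proof -
  have row: "A i j \<le> A i (j + 1)" if "i < n" "j + 1 < n" for i j
    using A that unfolding IMS2_def by blast
  have col: "A i j \<le> A (i + 1) j" if "i + 1 < n" "j < n" for i j
    using A that unfolding IMS2_def by blast
  have "A i j \<le> A i j'" using ij(3,4)
  proof (induction rule: dec_induct)
    case (step l)
    then show ?case using row[of i l] ij(1,2) by simp
  qed simp
  also have "A i j' \<le> A i' j'" using ij(1,2)
  proof (induction rule: dec_induct)
    case (step l)
    then show ?case using col[of l j'] ij(4) by simp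
  qed simp
  finally show ?thesis .
qed

lemma structure_exists:
  assumes m: "0 < m" "m < n" and A: "A \<in> IMS2 n m"
  obtains F k bs t where "\<And>i j. i < n \<Longrightarrow> j < n \<Longrightarrow> int (F i j) = A i j"
    "n \<le> 2 ^ k" "2 ^ k < 2 * n"
    "real (length bs) \<le> 82500 * (loglog (real n / real m) * (real n * real m))" "length bs < 2 ^ (32 * k)"
    "real t \<le> 15 * loglog (real n / real m)"
    "\<And>i j q. i < n \<Longrightarrow> j < n \<Longrightarrow> k \<le> q \<Longrightarrow> walk (32 * k) bs t 0 (32 * k) q 0 i j (F i j)"
proof -
  \<comment> \<open>Repeating the last row and column gives a monotone extension of any side without
    new values.\<close>
  define F where "F i j = nat (A (min i (n - 1)) (min j (n - 1)))" for i j
  define L where "L = loglog (real n / real m)"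
  have L: "1 \<le> L" by (simp add: L_def loglog_def)
  have mn: "min i (n - 1) < n" for i using m by simp
  have range: "0 \<le> A i j" "A i j < int m" if "i < n" "j < n" for i j using A that by (auto simp: IMS2_def)
  have FA: "int (F i j) = A i j" if "i < n" "j < n" for i j
  proof -
    have "min i (n - 1) = i" "min j (n - 1) = j" using that by linarith+
    then show ?thesis using range[OF that] by (simp add: F_def)
  qed
  have F: "mono2 S F" for S
    unfolding mono2_def F_def using mn by (auto intro!: nat_mono IMS2_mono[OF A] simp: min_le_iff_disj)
  have Fm: "F i j < m" for i j using range[OF mn mn, of i j] by (simp add: F_def nat_less_iff)
  \<comment> \<open>Because of the \<open>n - 1\<close>, this is the logarithm of \<open>n\<close>
    rounded up also for powers of two; hence \<open>2 ^ k < 2 * n\<close>.\<close>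
  define k where "k = bit_len (n - 1)"
  have k: "n \<le> 2 ^ k" "2 ^ k < 2 * n"
    using less_bit_len[of "n - 1"] bit_len_pow[of "n - 1"] m unfolding k_def by linarith+
  have "1 \<le> k" using k m by (cases k) auto
  then obtain s where s: "8 ^ s \<le> k" "k < 8 ^ Suc s" using ex_power_ivl1[of 8 k] by auto
  show ?thesis
  proof (cases "n \<le> 2 ^ s * m")
    case True
    obtain bs where bs: "length bs \<le> 7500 * (n * m)" "length bs < 2 ^ (32 * k)"
      "\<forall>i<2 ^ k. \<forall>j<2 ^ k. \<forall>q\<ge>k. walk (32 * k) bs 5 0 (32 * k) q 0 i j (F i j)"
      using shallow_structure[OF m F Fm k True s] by blast
    have "real (length bs) \<le> 7500 * (real n * real m)"
      using bs(1) by (metis of_nat_le_iff of_nat_mult of_nat_numeral)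
    also have "\<dots> \<le> 82500 * (L * (real n * real m))"
    proof -
      have "1 * (real n * real m) \<le> L * (real n * real m)" using L by (intro mult_right_mono) auto
      moreover have "0 \<le> real n * real m" by simp
      ultimately show ?thesis by linarith
    qed
    finally show ?thesis using k bs L FA unfolding L_def
      by (intro that[of F k bs 5]) auto
  next
    case False
    then have "2 ^ s * m < n" by simp
    from deep_structure[OF m F Fm k this s(2)] obtain bs e b where
      bs: "length bs \<le> 7500 * (Suc (depth e) * (n * m))" "length bs < 2 ^ (32 * k)" "e \<le> 2 * b" "2 ^ b * m < 2 * n"
      "\<forall>i<2 ^ k. \<forall>j<2 ^ k. \<forall>q\<ge>k. walk (32 * k) bs (depth e + 2) 0 (32 * k) q 0 i j (F i j)"
      by blast
    have d: "real (depth e) \<le> 10 * L" using depth_le_loglog[OF m bs(3,4)] by (simp add: L_def)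
    have "real (length bs) \<le> 7500 * (real (Suc (depth e)) * (real n * real m))"
      using bs(1) by (metis of_nat_le_iff of_nat_mult of_nat_numeral)
    also have "\<dots> \<le> 7500 * ((11 * L) * (real n * real m))"
      using d L by (intro mult_left_mono mult_right_mono) auto
    finally have "real (length bs) \<le> 82500 * (L * (real n * real m))" by simp
    then show ?thesis using k bs d L FA unfolding L_def
      by (intro that[of F k bs "depth e + 2"]) auto
  qed
qed

theorem theorem7:
  "\<exists>(P :: instr list) (c :: real) (C\<^sub>S :: real) (C\<^sub>T :: real). c \<ge> 1 \<and>
     (\<forall>(n :: nat) (m :: nat) (w :: nat) (A :: nat \<Rightarrow> nat \<Rightarrow> int).
        0 < m \<longrightarrow> m < n \<longrightarrow> A \<in> IMS2 n m \<longrightarrow> c * log 2 (real n) \<le> real w \<longrightarrow>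
        (\<exists>bs :: bool list.
           real (length bs) \<le> C\<^sub>S * (real n * real m * (loglog (real n / real m))\<^sup>2) \<and>
           (\<forall>i < n. \<forall>j < n.
              answers_within w P bs i j (A i j) (C\<^sub>T * loglog (real n / real m)))))"
proof (rule exI[of _ query_prog], rule exI[of _ 400], rule exI[of _ 100000], rule exI[of _ 1000],
    intro conjI allI impI)
  fix n m w :: nat and A :: "nat \<Rightarrow> nat \<Rightarrow> int"
  assume m: "0 < m" "m < n" and A: "A \<in> IMS2 n m" and w: "400 * log 2 (real n) \<le> real w"
  define L where "L = loglog (real n / real m)"
  have L: "1 \<le> L" by (simp add: L_def loglog_def)
  obtain F k bs t where F: "\<And>i j. i < n \<Longrightarrow> j < n \<Longrightarrow> int (F i j) = A i j"
    and k: "n \<le> 2 ^ k" "2 ^ k < 2 * n"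
    and bs: "real (length bs) \<le> 82500 * (L * (real n * real m))" "length bs < 2 ^ (32 * k)"
    and t: "real t \<le> 15 * L"
    and walk: "\<And>i j q. i < n \<Longrightarrow> j < n \<Longrightarrow> k \<le> q \<Longrightarrow> walk (32 * k) bs t 0 (32 * k) q 0 i j (F i j)"
    using structure_exists[OF m A] unfolding L_def by blast
  have k1: "1 \<le> k" using k m by (cases k) auto
  have n2: "2 \<le> n" using m by linarith
  \<comment> \<open>A record of six fields of \<open>32 * k\<close> bits, 192 k in all, has to fit
    into a word. As \<open>k < 1 + log 2 n <= 2 * log 2 n\<close>, the factor 400 provides 200 k
    bits.\<close>
  have kw: "200 * k \<le> w"
  proof -
    have "real (2 ^ k) < real (2 * n)" using k(2) by (simp only: of_nat_less_iff)
    then have "log 2 (2 ^ k) < log 2 (2 * real n)" using n2 by (intro log_less) auto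
    then have "real k < 1 + log 2 (real n)" using n2 by (simp add: log_mult)
    moreover have "log 2 2 \<le> log 2 (real n)" using n2 by (intro log_mono) auto
    ultimately have "200 * real k \<le> real w" using w by simp
    then show ?thesis by linarith
  qed
  have kn: "k \<le> n" using twice_le_exp[of k] k by linarith
  have lh: "length (header (32 * k) @ bs) = 64 * k + 2 + length bs" by (simp add: header_def)
  have p67: "2 * 2 ^ (66 * k) \<le> (2::nat) ^ w"
    using power_increasing[of "Suc (66 * k)" w "2::nat"] kw k1 by simp
  have small: "length (header (32 * k) @ bs) < 2 ^ w"
  proof -
    have "(2::nat) ^ (32 * k) \<le> 2 ^ (66 * k)" by (intro power_increasing) auto
    moreover have "64 * k + 2 < 2 ^ (66 * k)" using less_exp[of "66 * k"] k1 by linarith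
    ultimately show ?thesis unfolding lh using bs(2) p67 by linarith
  qed
  have nw: "n \<le> 2 ^ w" using k(1) power_increasing[of k w "2::nat"] kw by linarith
  have "real (length (header (32 * k) @ bs)) \<le> 100000 * (real n * real m * (loglog (real n / real m))\<^sup>2)"
  proof -
    \<comment> \<open>The structure takes O(n m L) bits; \<open>L >= 1\<close> gives the bound with
      the square.\<close>
    have LL: "L \<le> L\<^sup>2" using L by (simp add: power2_eq_square)
    have nm: "real n \<le> real n * real m" using m by simp
    have "0 \<le> real n * real m" by simp
    then have "real n * real m \<le> L * (real n * real m)" using mult_right_mono[OF L] by fastforce
    moreover have "real (length (header (32 * k) @ bs)) \<le> 66 * real n + real (length bs)"
      unfolding lh using kn n2 by simp
    ultimately have "real (length (header (32 * k) @ bs)) \<le> 100000 * (L * (real n * real m))"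
      using bs(1) nm by linarith
    also have "\<dots> \<le> 100000 * (L\<^sup>2 * (real n * real m))"
      using LL by (intro mult_left_mono mult_right_mono) auto
    finally show ?thesis by (simp add: L_def mult_ac)
  qed
  moreover have "answers_within w query_prog (header (32 * k) @ bs) i j (A i j) (1000 * loglog (real n / real m))"
    if ij: "i < n" "j < n" for i j
  proof -
    have "answers_within w query_prog (header (32 * k) @ bs) i j (int (F i j)) (1000 * L)"
    proof (rule answers_within_walk[where f = F and n = n and B = "32 * k" and t = t])
      fix i j assume ij: "i < n" "j < n"
      then show "walk (32 * k) bs t 0 (32 * k) w 0 i j (F i j)" using kw by (intro walk) auto
      have "A i j < int m" using A ij by (auto simp: IMS2_def)
      then show "F i j < 2 ^ w" using F[OF ij] m nw by linarith
    next
      show "real (40 * t + 14) \<le> 1000 * L" using t L by simp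
    qed (use kw k1 small nw ij in auto)
    then show ?thesis using F[OF ij] by (simp add: L_def)
  qed
  ultimately show "\<exists>bs. real (length bs) \<le> 100000 * (real n * real m * (loglog (real n / real m))\<^sup>2) \<and>
      (\<forall>i<n. \<forall>j<n. answers_within w query_prog bs i j (A i j) (1000 * loglog (real n / real m)))"
    by blast
qed simp

end
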